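(* Let $N$ be a finitely generated torsion-free nilpotent group of nilpotency class $c$, let $H\le N$ have finite index, and let $\phi:H\to N$ be a homomorphism. Let $\phi_i:H_iN_{i+1}/N_{i+1}\to N_i/N_{i+1}$ ($1\le i\le c$) be the induced morphisms. Then \[R(\phi)=\prod_{i=1}^cR(\phi_i),\] where a product containing a factor $\infty$ is $\infty$.
   Context: Lower central series: $\gamma_1(K)=K$, $\gamma_{i+1}(K)=[K,\gamma_i(K)]$. Isolator: $\sqrt[K]{L}=\{x\in K:\exists m>0,\ x^m\in L\}$. $N_i=\sqrt[N]{\gamma_i(N)}$ and $H_i=\sqrt[H]{\gamma_i(H)}$, with $N_{c+1}=1$. $\phi_i$ is defined by $hN_{i+1}\mapsto\phi(h)N_{i+1}$ for $h\in H_i$; it is a well-defined homomorphism from the finite-index subgroup $H_iN_{i+1}/N_{i+1}$ of the abelian group $N_i/N_{i+1}$ into $N_i/N_{i+1}$. For a group $K$, a finite-index subgroup $L$ and a homomorphism $\phi:L\to K$, $R(\phi)$ is the number (possibly $\infty$) of classes of the relation $\alpha\sim_\phi\beta\iff\exists\gamma\in L:\ \alpha=\gamma\beta\phi(\gamma^{-1})$ on $K$. *)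

theory Defs
  imports "HOL-Algebra.Algebra" "HOL-Library.Extended_Nat"
begin

definition comm_subgroup :: "('a, 'b) monoid_scheme \<Rightarrow> 'a set \<Rightarrow> 'a set \<Rightarrow> 'a set" where
  "comm_subgroup G A B = generate G (\<Union>a\<in>A. \<Union>b\<in>B.
      {a \<otimes>\<^bsub>G\<^esub> b \<otimes>\<^bsub>G\<^esub> inv\<^bsub>G\<^esub> a \<otimes>\<^bsub>G\<^esub> inv\<^bsub>G\<^esub> b})"

text \<open>Lower central series, indexed as in the paper: lcs G 1 = G, lcs G (i+1) = [G, lcs G i].
  (Index 0 is unused and also set to G.)\<close>
primrec lcs :: "('a, 'b) monoid_scheme \<Rightarrow> nat \<Rightarrow> 'a set" where
  "lcs G 0 = carrier G"
| "lcs G (Suc n) = (if n = 0 then carrier G else comm_subgroup G (carrier G) (lcs G n))"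

definition isolator :: "('a, 'b) monoid_scheme \<Rightarrow> 'a set \<Rightarrow> 'a set" where
  "isolator G L = {x \<in> carrier G. \<exists>m::nat. m > 0 \<and> x [^]\<^bsub>G\<^esub> m \<in> L}"

definition finitely_generated :: "('a, 'b) monoid_scheme \<Rightarrow> bool" where
  "finitely_generated G \<longleftrightarrow> (\<exists>S. finite S \<and> S \<subseteq> carrier G \<and> generate G S = carrier G)"

definition torsion_free :: "('a, 'b) monoid_scheme \<Rightarrow> bool" where
  "torsion_free G \<longleftrightarrow> (\<forall>x\<in>carrier G. \<forall>n::nat. n > 0 \<longrightarrow> x [^]\<^bsub>G\<^esub> n = \<one>\<^bsub>G\<^esub> \<longrightarrow> x = \<one>\<^bsub>G\<^esub>)"

definition nilpotent_class :: "('a, 'b) monoid_scheme \<Rightarrow> nat \<Rightarrow> bool" where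
  "nilpotent_class G c \<longleftrightarrow> lcs G (Suc c) = {\<one>\<^bsub>G\<^esub>} \<and> (\<forall>k<c. lcs G (Suc k) \<noteq> {\<one>\<^bsub>G\<^esub>})"

definition finite_index :: "'a set \<Rightarrow> ('a, 'b) monoid_scheme \<Rightarrow> bool" where
  "finite_index H G \<longleftrightarrow> subgroup H G \<and> finite (rcosets\<^bsub>G\<^esub> H)"

definition reid_rel :: "('a, 'b) monoid_scheme \<Rightarrow> 'a set \<Rightarrow> ('a \<Rightarrow> 'a) \<Rightarrow> ('a \<times> 'a) set" where
  "reid_rel K L \<phi> = {(\<alpha>, \<beta>). \<alpha> \<in> carrier K \<and> \<beta> \<in> carrier K \<and>
      (\<exists>\<gamma>\<in>L. \<alpha> = \<gamma> \<otimes>\<^bsub>K\<^esub> \<beta> \<otimes>\<^bsub>K\<^esub> \<phi> (inv\<^bsub>K\<^esub> \<gamma>))}"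

definition reidemeister :: "('a, 'b) monoid_scheme \<Rightarrow> 'a set \<Rightarrow> ('a \<Rightarrow> 'a) \<Rightarrow> enat" where
  "reidemeister K L \<phi> =
     (if finite (carrier K // reid_rel K L \<phi>) then enat (card (carrier K // reid_rel K L \<phi>)) else \<infinity>)"

definition iso_lcs :: "('a, 'b) monoid_scheme \<Rightarrow> nat \<Rightarrow> 'a set" where
  "iso_lcs G i = isolator G (lcs G i)"

definition layer :: "('a, 'b) monoid_scheme \<Rightarrow> nat \<Rightarrow> 'a set monoid" where
  "layer N i = (N\<lparr>carrier := iso_lcs N i\<rparr>) Mod (iso_lcs N (Suc i))"

definition layer_dom :: "('a, 'b) monoid_scheme \<Rightarrow> 'a set \<Rightarrow> nat \<Rightarrow> 'a set set" where
  "layer_dom N H i = (\<lambda>h. iso_lcs N (Suc i) #>\<^bsub>N\<^esub> h) ` iso_lcs (N\<lparr>carrier := H\<rparr>) i"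

definition induced_map :: "('a, 'b) monoid_scheme \<Rightarrow> 'a set \<Rightarrow> ('a \<Rightarrow> 'a) \<Rightarrow> nat \<Rightarrow> 'a set \<Rightarrow> 'a set" where
  "induced_map N H \<phi> i C = iso_lcs N (Suc i) #>\<^bsub>N\<^esub>
      \<phi> (SOME h. h \<in> iso_lcs (N\<lparr>carrier := H\<rparr>) i \<and> C = iso_lcs N (Suc i) #>\<^bsub>N\<^esub> h)"

end

theory Submission
  imports Defs
begin

text \<open>
  Write N_i for the isolator of the i-th term of the lower central series of N, and let R_i count
  the classes of the Reidemeister relation modulo N_i, so that R_1 = 1 and R_(c+1) = R(\<phi>).
  Each layer N_i / N_(i+1) is central in N / N_(i+1), torsion-free and of finite rank.
  If R_i is finite, then no twisted conjugation a \<mapsto> g a \<phi>(g)\<inverse> modulo N_i has a fixed point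
  unless g lies in N_i. Hence every class modulo N_i splits into exactly R(\<phi>_i) classes modulo
  N_(i+1), that is, R_(i+1) = R_i R(\<phi>_i). If moreover R(\<phi>_i) is finite, then
  g \<mapsto> g \<phi>_i(g)\<inverse> has image of finite index in the layer, so it is injective for reasons of rank,
  and freeness from fixed points carries over to N_(i+1). If R_i is infinite, so is R_(i+1).

  That the isolators are subgroups, and that the isolated series of a finite-index subgroup H is
  the trace on H of that of N, follows from bilinearity of commutators: if generators of a
  nilpotent group have powers in a subgroup, then so has every element.
\<close>

section \<open>Commutators and the lower central series\<close>

text \<open>Freeness is what makes the splitting exact. The classes modulo N_(i+1) inside the class
  of a modulo N_i correspond to the orbits on the coset N_i a of the stabilizer of a modulo N_i
  under twisted conjugation. This stabilizer always contains H_i, and only when it is no larger does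
  the count reduce to R(\<phi>_i). Freeness at the next level in turn needs finiteness of the count,
  so counting and freeness are carried through one induction, which starts at N_1 = N, where
  freeness is trivial. Isolators are essential: the layers of the lower central series itself may
  have torsion, and then equality of ranks does not give injectivity. The price is that \<phi>,
  defined only on H, must be shown to respect the isolated series, which rests on H_i being the
  intersection of H with N_i. The relations modulo the various N_i are all placed on the elements of
  N, so that they share one carrier and can be compared by inclusion. Ranks are handled by integer
  exponent vectors instead of rational vector spaces.\<close>

definition commutator :: "('a, 'b) monoid_scheme \<Rightarrow> 'a \<Rightarrow> 'a \<Rightarrow> 'a" where
  "commutator G a b = a \<otimes>\<^bsub>G\<^esub> b \<otimes>\<^bsub>G\<^esub> inv\<^bsub>G\<^esub> a \<otimes>\<^bsub>G\<^esub> inv\<^bsub>G\<^esub> b"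

context group
begin

lemma mult_inv_cancel_left:
  assumes "a \<in> carrier G" "b \<in> carrier G"
  shows "a \<otimes> (inv a \<otimes> b) = b" "inv a \<otimes> (a \<otimes> b) = b"
  using assms by (simp_all flip: m_assoc)

lemmas group_normalize = m_assoc inv_mult_group mult_inv_cancel_left

lemma commutator_closed [simp, intro]:
  "a \<in> carrier G \<Longrightarrow> b \<in> carrier G \<Longrightarrow> commutator G a b \<in> carrier G"
  by (simp add: commutator_def)

lemma commutator_mult_left:
  assumes "a \<in> carrier G" "b \<in> carrier G" "x \<in> carrier G"
  shows "commutator G (a \<otimes> b) x = a \<otimes> commutator G b x \<otimes> inv a \<otimes> commutator G a x"
  using assms by (simp add: commutator_def group_normalize)

lemma commutator_mult_right:
  assumes "a \<in> carrier G" "x \<in> carrier G" "y \<in> carrier G"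
  shows "commutator G a (x \<otimes> y) = commutator G a x \<otimes> (x \<otimes> commutator G a y \<otimes> inv x)"
  using assms by (simp add: commutator_def group_normalize)

lemma commutator_inv_left:
  assumes "a \<in> carrier G" "x \<in> carrier G"
  shows "commutator G (inv a) x = inv a \<otimes> inv (commutator G a x) \<otimes> a"
  using assms by (simp add: commutator_def group_normalize)

lemma commutator_inv_right:
  assumes "a \<in> carrier G" "x \<in> carrier G"
  shows "commutator G a (inv x) = inv x \<otimes> inv (commutator G a x) \<otimes> x"
  using assms by (simp add: commutator_def group_normalize)

lemma inv_commutator:
  assumes "a \<in> carrier G" "x \<in> carrier G"
  shows "inv (commutator G a x) = commutator G x a"
  using assms by (simp add: commutator_def group_normalize)

lemma conj_eq_commutator_mult:
  assumes "a \<in> carrier G" "x \<in> carrier G"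
  shows "a \<otimes> x \<otimes> inv a = commutator G a x \<otimes> x"
  using assms by (simp add: commutator_def group_normalize)

lemma commutator_eq_one_iff:
  assumes "a \<in> carrier G" "x \<in> carrier G"
  shows "commutator G a x = \<one> \<longleftrightarrow> a \<otimes> x = x \<otimes> a"
proof -
  have "commutator G a x = (a \<otimes> x) \<otimes> inv (x \<otimes> a)"
    using assms by (simp add: commutator_def group_normalize)
  then show ?thesis
    using assms by (metis inv_closed inv_equality inv_inv m_closed r_inv)
qed

lemma conj_nat_pow:
  assumes "a \<in> carrier G" "x \<in> carrier G"
  shows "(a \<otimes> x \<otimes> inv a) [^] (n::nat) = a \<otimes> x [^] n \<otimes> inv a"
  using assms by (induction n) (simp_all add: group_normalize)

text \<open>Conjugating x^n by a gives ([a,x] x)^n, and the two commuting factors separate.\<close>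

lemma commutator_pow_right:
  assumes "a \<in> carrier G" "x \<in> carrier G"
    and "commutator G a x \<otimes> x = x \<otimes> commutator G a x"
  shows "commutator G a (x [^] (n::nat)) = commutator G a x [^] n"
proof -
  have "a \<otimes> x [^] n \<otimes> inv a = (commutator G a x \<otimes> x) [^] n"
    using assms by (simp flip: conj_nat_pow conj_eq_commutator_mult)
  also have "\<dots> = commutator G a x [^] n \<otimes> x [^] n"
    using assms by (intro pow_mult_distrib) simp_all
  finally have "commutator G a x [^] n = (a \<otimes> x [^] n \<otimes> inv a) \<otimes> inv (x [^] n)"
    using assms(1,2) by (simp add: m_assoc)
  then show ?thesis
    by (simp add: commutator_def)
qed

text \<open>Swapping the arguments inverts the commutator, so this reduces to
  \<open>commutator_pow_right\<close>.\<close>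

lemma commutator_pow_left:
  assumes "a \<in> carrier G" "x \<in> carrier G"
    and "commutator G a x \<otimes> a = a \<otimes> commutator G a x"
  shows "commutator G (a [^] (n::nat)) x = commutator G a x [^] n"
proof -
  have "commutator G x a \<otimes> a = a \<otimes> commutator G x a"
  proof -
    let ?u = "commutator G a x"
    have "inv ?u \<otimes> a = inv ?u \<otimes> (a \<otimes> ?u) \<otimes> inv ?u"
      using assms(1,2) by (simp add: group_normalize)
    also have "\<dots> = a \<otimes> inv ?u"
      using assms(1,2) unfolding assms(3)[symmetric] by (simp add: group_normalize)
    finally show ?thesis using assms(1,2) by (simp add: inv_commutator)
  qed
  then have "commutator G x (a [^] n) = commutator G x a [^] n"
    using assms by (intro commutator_pow_right)
  then show ?thesis
    using assms(1,2) by (metis commutator_closed inv_commutator nat_pow_closed nat_pow_inv)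
qed

end

section \<open>Commutators and powers modulo a normal subgroup\<close>

context normal
begin

lemma group_hom_coset: "group_hom G (G Mod H) ((#>) H)"
  by (simp add: factorgroup_is_group group_hom.intro group_hom_axioms.intro is_group r_coset_hom_Mod)

lemma coset_eq_iff:
  assumes "a \<in> carrier G" "b \<in> carrier G"
  shows "H #> a = H #> b \<longleftrightarrow> a \<otimes> inv b \<in> H"
  by (metis assms group.rcos_self is_group rcos_module repr_independence subgroup_axioms)

lemma coset_eq_one_iff: "a \<in> carrier G \<Longrightarrow> H #> a = \<one>\<^bsub>G Mod H\<^esub> \<longleftrightarrow> a \<in> H"
  by (metis coset_join1 coset_join2 one_FactGroup subgroup_axioms)

text \<open>A subgroup above \<open>H\<close> is a union of cosets of \<open>H\<close>. Congruences
  computed in the quotient can therefore decide membership in \<open>V\<close>, even if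
  \<open>V\<close> is not normal.\<close>

lemma mem_supergroup_cong:
  assumes "subgroup V G" "H \<subseteq> V" "a \<in> carrier G" "b \<in> carrier G" "H #> a = H #> b"
  shows "a \<in> V \<longleftrightarrow> b \<in> V"
proof -
  have 1: "a \<otimes> inv b \<in> V" using assms coset_eq_iff by blast
  then have 2: "b \<otimes> inv a \<in> V"
    using assms by (metis inv_closed inv_inv inv_mult_group subgroupE(3))
  have "a = (a \<otimes> inv b) \<otimes> b" "b = (b \<otimes> inv a) \<otimes> a"
    using assms by (simp_all add: group_normalize)
  then show ?thesis
    using subgroup.m_closed[OF assms(1) 1, of b] subgroup.m_closed[OF assms(1) 2, of a] by auto
qed

lemma coset_commutator:
  assumes "a \<in> carrier G" "b \<in> carrier G"
  shows "H #> commutator G a b = commutator (G Mod H) (H #> a) (H #> b)"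
proof -
  interpret q: group_hom G "G Mod H" "(#>) H" by (rule group_hom_coset)
  show ?thesis using assms by (simp add: commutator_def q.hom_mult q.hom_inv del: mult_FactGroup)
qed

lemma commute_mod_iff:
  assumes "a \<in> carrier G" "b \<in> carrier G"
  shows "(H #> a) \<otimes>\<^bsub>G Mod H\<^esub> (H #> b) = (H #> b) \<otimes>\<^bsub>G Mod H\<^esub> (H #> a) \<longleftrightarrow> commutator G a b \<in> H"
proof -
  interpret q: group_hom G "G Mod H" "(#>) H" by (rule group_hom_coset)
  show ?thesis
    using assms q.H.commutator_eq_one_iff[of "H #> a" "H #> b"] q.hom_closed
    by (metis coset_commutator coset_eq_one_iff commutator_closed)
qed

lemma pow_mult_mod:
  assumes "subgroup V G" "H \<subseteq> V" "a \<in> carrier G" "b \<in> carrier G" "commutator G a b \<in> H"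
    and "a [^] (k::nat) \<in> V" "b [^] k \<in> V"
  shows "(a \<otimes> b) [^] k \<in> V"
proof -
  interpret q: group_hom G "G Mod H" "(#>) H" by (rule group_hom_coset)
  have "H #> (a \<otimes> b) [^] k = ((H #> a) \<otimes>\<^bsub>G Mod H\<^esub> (H #> b)) [^]\<^bsub>G Mod H\<^esub> k"
    using assms by (simp add: q.hom_nat_pow del: mult_FactGroup)
  also have "\<dots> = (H #> a) [^]\<^bsub>G Mod H\<^esub> k \<otimes>\<^bsub>G Mod H\<^esub> (H #> b) [^]\<^bsub>G Mod H\<^esub> k"
    using assms by (intro q.H.pow_mult_distrib) (simp_all add: commute_mod_iff del: mult_FactGroup)
  also have "\<dots> = H #> (a [^] k \<otimes> b [^] k)"
    using assms by (simp add: q.hom_nat_pow del: mult_FactGroup)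
  finally have "H #> (a \<otimes> b) [^] k = H #> (a [^] k \<otimes> b [^] k)" .
  then show ?thesis
    using mem_supergroup_cong[OF assms(1,2), of "(a \<otimes> b) [^] k" "a [^] k \<otimes> b [^] k"]
      subgroup.m_closed[OF assms(1,6,7)] assms(3,4) by blast
qed

lemma commutator_pow_right_mod:
  assumes "a \<in> carrier G" "x \<in> carrier G" "commutator G (commutator G a x) x \<in> H"
  shows "H #> commutator G a (x [^] (n::nat)) = H #> commutator G a x [^] n"
proof -
  interpret q: group_hom G "G Mod H" "(#>) H" by (rule group_hom_coset)
  have "commutator (G Mod H) (H #> a) ((H #> x) [^]\<^bsub>G Mod H\<^esub> n) = commutator (G Mod H) (H #> a) (H #> x) [^]\<^bsub>G Mod H\<^esub> n"
    using assms by (intro q.H.commutator_pow_right)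
      (simp_all add: commute_mod_iff del: mult_FactGroup flip: coset_commutator)
  then show ?thesis
    using assms by (simp add: coset_commutator q.hom_nat_pow)
qed

lemma commutator_pow_left_mod:
  assumes "a \<in> carrier G" "x \<in> carrier G" "commutator G (commutator G a x) a \<in> H"
  shows "H #> commutator G (a [^] (n::nat)) x = H #> commutator G a x [^] n"
proof -
  interpret q: group_hom G "G Mod H" "(#>) H" by (rule group_hom_coset)
  have "commutator (G Mod H) ((H #> a) [^]\<^bsub>G Mod H\<^esub> n) (H #> x) = commutator (G Mod H) (H #> a) (H #> x) [^]\<^bsub>G Mod H\<^esub> n"
    using assms by (intro q.H.commutator_pow_left)
      (simp_all add: commute_mod_iff del: mult_FactGroup flip: coset_commutator)
  then show ?thesis
    using assms by (simp add: coset_commutator q.hom_nat_pow)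
qed

end

section \<open>The lower central series\<close>

lemma comm_subgroup_eq_generate:
  "comm_subgroup G A B = generate G {commutator G a b |a b. a \<in> A \<and> b \<in> B}"
  unfolding comm_subgroup_def commutator_def by (rule arg_cong[of _ _ "generate G"]) blast

lemma (in group_hom) hom_commutator:
  "a \<in> carrier G \<Longrightarrow> b \<in> carrier G \<Longrightarrow> h (commutator G a b) = commutator H (h a) (h b)"
  by (simp add: commutator_def)

context group
begin

lemma lcs_subgroup: "subgroup (lcs G n) G"
proof (induction n)
  case (Suc n)
  then show ?case
    by (auto simp: comm_subgroup_eq_generate subgroup_self dest: subgroup.subset intro!: generate_is_subgroup)
qed (simp add: subgroup_self)

lemma lcs_subset: "lcs G n \<subseteq> carrier G"
  using lcs_subgroup subgroup.subset by blast

lemma commutator_lcs: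
  assumes "a \<in> carrier G" "x \<in> lcs G n"
  shows "commutator G a x \<in> lcs G (Suc n)"
proof (cases "n = 0")
  case False
  then show ?thesis using assms by (auto simp: comm_subgroup_eq_generate intro: generate.incl)
qed (use assms in simp)

lemma lcs_Suc_subset_iff:
  assumes "n > 0" "subgroup W G"
  shows "lcs G (Suc n) \<subseteq> W \<longleftrightarrow> (\<forall>a\<in>carrier G. \<forall>x\<in>lcs G n. commutator G a x \<in> W)"
proof
  assume "\<forall>a\<in>carrier G. \<forall>x\<in>lcs G n. commutator G a x \<in> W"
  then have "{commutator G a b |a b. a \<in> carrier G \<and> b \<in> lcs G n} \<subseteq> W"
    by blast
  then show "lcs G (Suc n) \<subseteq> W"
    using assms generate_subgroup_incl by (simp add: comm_subgroup_eq_generate)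
qed (use commutator_lcs in blast)

lemma lcs_Suc_subset: "lcs G (Suc n) \<subseteq> lcs G n"
proof (induction n)
  case (Suc n)
  show ?case
    using Suc commutator_lcs by (intro lcs_Suc_subset_iff[THEN iffD2]) (auto simp del: lcs.simps intro: lcs_subgroup)
qed simp

lemma lcs_antimono: "m \<le> n \<Longrightarrow> lcs G n \<subseteq> lcs G m"
  by (rule lift_Suc_antimono_le) (rule lcs_Suc_subset)

lemma normal_if_commutators:
  assumes "subgroup W G" "\<And>a w. a \<in> carrier G \<Longrightarrow> w \<in> W \<Longrightarrow> commutator G a w \<in> W"
  shows "W \<lhd> G"
  unfolding normal_inv_iff using assms
  by (metis conj_eq_commutator_mult subgroup.m_closed subgroup.mem_carrier)

lemma lcs_normal: "lcs G n \<lhd> G"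
  using commutator_lcs lcs_Suc_subset by (intro normal_if_commutators lcs_subgroup) blast

end

lemma (in group_hom) lcs_hom_image: "h ` lcs G n \<subseteq> lcs H n"
proof (induction n)
  case (Suc n)
  show ?case
  proof (cases "n = 0")
    case False
    let ?A = "{commutator G a b |a b. a \<in> carrier G \<and> b \<in> lcs G n}"
    have sub: "?A \<subseteq> carrier G" using G.lcs_subset by blast
    have "h ` ?A \<subseteq> {commutator H a b |a b. a \<in> carrier H \<and> b \<in> lcs H n}"
    proof clarify
      fix a b assume "a \<in> carrier G" "b \<in> lcs G n"
      moreover have "b \<in> carrier G" using \<open>b \<in> lcs G n\<close> G.lcs_subset by blast
      ultimately show "\<exists>a' b'. h (commutator G a b) = commutator H a' b' \<and> a' \<in> carrier H \<and> b' \<in> lcs H n"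
        using Suc hom_commutator hom_closed by blast
    qed
    then have "h ` generate G ?A \<subseteq> lcs H (Suc n)"
      using False sub by (auto simp: comm_subgroup_eq_generate simp flip: generate_img dest: mono_generate)
    then show ?thesis
      using False by (simp add: comm_subgroup_eq_generate)
  qed auto
qed auto

lemma (in group) lcs_subgroup_mono:
  assumes "subgroup K G"
  shows "lcs (G\<lparr>carrier := K\<rparr>) n \<subseteq> lcs G n"
proof -
  have "group_hom (G\<lparr>carrier := K\<rparr>) G (\<lambda>x. x)"
    using assms subgroup.subset
    by (auto simp: group_hom_def group_hom_axioms_def hom_def subgroup_imp_group)
  from group_hom.lcs_hom_image[OF this] show ?thesis by auto
qed

section \<open>Isolators in nilpotent groups\<close>

context group
begin

lemma subgroup_pow_mult:
  assumes "subgroup V G" "x \<in> carrier G" "x [^] (k::nat) \<in> V"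
  shows "x [^] (k * l) \<in> V" "x [^] (l * k) \<in> V"
proof -
  have "(x [^] k) [^] l \<in> V"
  proof (induction l)
    case 0
    then show ?case using assms subgroup.one_closed by simp
  next
    case (Suc l)
    then show ?case using assms subgroup.m_closed by fastforce
  qed
  then show "x [^] (k * l) \<in> V" "x [^] (l * k) \<in> V"
    using assms(2) by (simp_all add: nat_pow_pow mult.commute)
qed

lemma lcs_sub_subgroup:
  assumes "subgroup K G"
  shows "subgroup (lcs (G\<lparr>carrier := K\<rparr>) n) G"
  using assms group.lcs_subgroup[OF subgroup_imp_group] incl_subgroup by blast

lemma commutator_sub:
  assumes "subgroup K G" "a \<in> K" "b \<in> K"
  shows "commutator (G\<lparr>carrier := K\<rparr>) a b = commutator G a b"
  using assms by (simp add: commutator_def m_inv_consistent)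

end

context normal
begin

text \<open>The set is closed under products because \<open>A\<close> is commutative modulo
  \<open>H\<close>: if a^k and b^l lie in \<open>V\<close>, the common exponent k l works for a
  b.\<close>

lemma roots_subgroup:
  assumes "subgroup V G" "H \<subseteq> V" "subgroup A G"
    and "\<And>a b. a \<in> A \<Longrightarrow> b \<in> A \<Longrightarrow> commutator G a b \<in> H"
  shows "subgroup {w \<in> A. \<exists>k::nat. k > 0 \<and> w [^] k \<in> V} G" (is "subgroup ?W G")
proof (rule subgroupI)
  have A: "A \<subseteq> carrier G" using assms(3) subgroup.subset by blast
  then show "?W \<subseteq> carrier G" by blast
  have "\<one> \<in> ?W"
    using subgroup.one_closed[OF assms(3)] subgroup.one_closed[OF assms(1)] by (auto intro!: exI[of _ 1])
  then show "?W \<noteq> {}" by blast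
  fix a assume a: "a \<in> ?W"
  then obtain k :: nat where k: "k > 0" "a [^] k \<in> V" by blast
  have aA: "a \<in> A" "a \<in> carrier G" using a A by auto
  have "(inv a) [^] k \<in> V"
    using k aA assms(1) by (simp add: nat_pow_inv subgroup.m_inv_closed)
  then show "inv a \<in> ?W"
    using k aA subgroup.m_inv_closed[OF assms(3)] by blast
  fix b assume b: "b \<in> ?W"
  then obtain l :: nat where l: "l > 0" "b [^] l \<in> V" by blast
  have bA: "b \<in> A" "b \<in> carrier G" using b A by auto
  have "(a \<otimes> b) [^] (k * l) \<in> V"
    using aA bA assms subgroup_pow_mult(1)[OF assms(1) aA(2) k(2)]
      subgroup_pow_mult(2)[OF assms(1) bA(2) l(2)] by (intro pow_mult_mod) auto
  then show "a \<otimes> b \<in> ?W"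
    using k l aA bA subgroup.m_closed[OF assms(3)] by (auto intro!: exI[of _ "k * l"])
qed

text \<open>This is the preimage of the centralizer of a coset. As it is a subgroup, membership has
  to be checked on generators only.\<close>

lemma centralizing_right_subgroup:
  assumes "a \<in> carrier G"
  shows "subgroup {x \<in> carrier G. commutator G a x \<in> H} G"
proof (rule subgroupI)
  have "commutator G a \<one> \<in> H" using assms by (simp add: commutator_def)
  then show "{x \<in> carrier G. commutator G a x \<in> H} \<noteq> {}" by blast
qed (use assms in \<open>auto simp: commutator_mult_right commutator_inv_right intro: inv_op_closed1 inv_op_closed2\<close>)

lemma centralizing_left_subgroup:
  assumes "x \<in> carrier G"
  shows "subgroup {a \<in> carrier G. commutator G a x \<in> H} G"
proof (rule subgroupI)
  have "commutator G \<one> x \<in> H" using assms by (simp add: commutator_def)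
  then show "{a \<in> carrier G. commutator G a x \<in> H} \<noteq> {}" by blast
qed (use assms in \<open>auto simp: commutator_mult_left commutator_inv_left intro: inv_op_closed1 inv_op_closed2\<close>)

end

section \<open>Propagating roots along the lower central series\<close>

context group
begin

text \<open>The quotient of two consecutive terms is central, so all its subgroups are
  normal.\<close>

lemma normal_between_lcs:
  assumes "subgroup W G" "lcs G (Suc n) \<subseteq> W" "W \<subseteq> lcs G n"
  shows "W \<lhd> G"
  using assms commutator_lcs by (intro normal_if_commutators) blast+

text \<open>Bilinearity of the commutator modulo \<open>W\<close>, expressed by centralizers: first
  s is fixed and x runs from \<open>D\<close> to all of \<open>lcs G n\<close>, then x is fixed and
  s runs from \<open>S\<close> to the whole group. It serves both to find roots and to find finitely
  many generators of a layer.\<close>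

lemma lcs_Suc_subset_if_generators:
  assumes "n > 0" "generate G S = carrier G" "S \<subseteq> carrier G"
    and D: "D \<subseteq> carrier G" "lcs G n \<subseteq> generate G (D \<union> lcs G (Suc n))"
    and W: "subgroup W G" "lcs G (Suc (Suc n)) \<subseteq> W" "W \<subseteq> lcs G (Suc n)"
    and comm: "\<And>s x. s \<in> S \<Longrightarrow> x \<in> D \<Longrightarrow> commutator G s x \<in> W"
  shows "lcs G (Suc n) \<subseteq> W"
proof -
  interpret W: normal W G using W by (rule normal_between_lcs)
  have gens: "commutator G s x \<in> W" if "s \<in> S" "x \<in> lcs G n" for s x
  proof -
    have s: "s \<in> carrier G" using that assms(3) by blast
    have "D \<union> lcs G (Suc n) \<subseteq> {x \<in> carrier G. commutator G s x \<in> W}"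
      using that s D(1) comm W(2) commutator_lcs[OF s, of _ "Suc n"] lcs_subset by blast
    then show ?thesis
      using generate_subgroup_incl[OF _ W.centralizing_right_subgroup[OF s]] D(2) that by blast
  qed
  have "commutator G a x \<in> W" if "a \<in> carrier G" "x \<in> lcs G n" for a x
  proof -
    have x: "x \<in> carrier G" using that lcs_subset by blast
    have "S \<subseteq> {a \<in> carrier G. commutator G a x \<in> W}"
      using gens that assms(3) by blast
    then show ?thesis
      using generate_subgroup_incl[OF _ W.centralizing_left_subgroup[OF x]] assms(2) that by blast
  qed
  then show ?thesis
    using lcs_Suc_subset_iff[OF assms(1) W(1)] by blast
qed

lemma lcs_mult_subgroup:
  assumes "subgroup L G"
  shows "subgroup (lcs G n <#> L) G" "lcs G n \<subseteq> lcs G n <#> L" "L \<subseteq> lcs G n <#> L"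
proof -
  interpret second_isomorphism_grp "lcs G n" G L
    using assms lcs_normal[of n] by (simp add: second_isomorphism_grp_def second_isomorphism_grp_axioms_def)
  show "subgroup (lcs G n <#> L) G" by (rule normal_set_mult_subgroup)
  show "lcs G n \<subseteq> lcs G n <#> L" by (rule H_contained_in_set_mult)
  show "L \<subseteq> lcs G n <#> L" by (rule S_contained_in_set_mult)
qed

text \<open>The commutator map makes lcs G (n+1) / lcs G (n+2) a bilinear image of G and
  lcs G n / lcs G (n+1), so virtual containment of generators propagates down the series.\<close>

lemma lcs_roots_mod_next:
  assumes H: "subgroup H G" and S: "generate G S = carrier G" "S \<subseteq> carrier G"
    and roots: "\<And>s. s \<in> S \<Longrightarrow> \<exists>m::nat. m > 0 \<and> s [^] m \<in> H"
    and "n > 0" "x \<in> lcs G n"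
  shows "\<exists>k::nat. k > 0 \<and> x [^] k \<in> lcs G (Suc n) <#> lcs (G\<lparr>carrier := H\<rparr>) n"
  using \<open>n > 0\<close> \<open>x \<in> lcs G n\<close>
proof (induction n arbitrary: x rule: nat_induct_non_zero)
  case 1
  define V where "V = lcs G 2 <#> H"
  have V: "subgroup V G" "lcs G 2 \<subseteq> V" "H \<subseteq> V"
    unfolding V_def using H by (rule lcs_mult_subgroup)+
  interpret T: normal "lcs G 2" G by (rule lcs_normal)
  have "commutator G a b \<in> lcs G 2" if "a \<in> carrier G" "b \<in> carrier G" for a b
    using commutator_lcs[of a b 1] that by (simp add: numeral_2_eq_2)
  then have "subgroup {w \<in> carrier G. \<exists>k::nat. k > 0 \<and> w [^] k \<in> V} G"
    by (intro T.roots_subgroup V subgroup_self)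
  moreover have "S \<subseteq> {w \<in> carrier G. \<exists>k::nat. k > 0 \<and> w [^] k \<in> V}"
    using S(2) roots V(3) by blast
  ultimately have "generate G S \<subseteq> {w \<in> carrier G. \<exists>k::nat. k > 0 \<and> w [^] k \<in> V}"
    by (rule generate_subgroup_incl[rotated])
  then show ?case
    using 1 S(1) by (auto simp: V_def numeral_2_eq_2)
next
  case (Suc n)
  define HH where "HH = lcs (G\<lparr>carrier := H\<rparr>) (Suc n)"
  define V where "V = lcs G (Suc (Suc n)) <#> HH"
  have V: "subgroup V G" "lcs G (Suc (Suc n)) \<subseteq> V" "HH \<subseteq> V"
    unfolding V_def HH_def by (rule lcs_mult_subgroup lcs_sub_subgroup H)+
  have "HH \<subseteq> lcs G (Suc n)" unfolding HH_def by (rule lcs_subgroup_mono[OF H])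
  then have "V \<subseteq> lcs G (Suc n)"
    unfolding V_def set_mult_def using lcs_Suc_subset[of "Suc n"] subgroup.m_closed[OF lcs_subgroup[of "Suc n"]] by blast
  then interpret V: normal V G using V normal_between_lcs by blast
  interpret T: normal "lcs G (Suc (Suc n))" G by (rule lcs_normal)
  define W where "W = {w \<in> lcs G (Suc n). \<exists>k::nat. k > 0 \<and> w [^] k \<in> V}"
  have W: "subgroup W G"
    unfolding W_def using commutator_lcs lcs_subset by (intro T.roots_subgroup V lcs_subgroup) blast
  have TW: "lcs G (Suc (Suc n)) \<subseteq> W"
  proof
    fix w assume w: "w \<in> lcs G (Suc (Suc n))"
    then have "w [^] (1::nat) \<in> V" using V(2) lcs_subset by (auto simp del: lcs.simps)
    then show "w \<in> W" using w lcs_Suc_subset[of "Suc n"] unfolding W_def by blast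
  qed
  have "commutator G s x \<in> W" if s: "s \<in> S" and x: "x \<in> lcs G n" for s x
  proof -
    have car: "s \<in> carrier G" "x \<in> carrier G" using s x S(2) lcs_subset by blast+
    obtain m :: nat where m: "m > 0" "s [^] m \<in> H" using roots s by blast
    obtain k :: nat where k: "k > 0" "x [^] k \<in> lcs G (Suc n) <#> lcs (G\<lparr>carrier := H\<rparr>) n"
      using Suc.IH x by blast
    then obtain z y where zy: "z \<in> lcs G (Suc n)" "y \<in> lcs (G\<lparr>carrier := H\<rparr>) n" "x [^] k = z \<otimes> y"
      unfolding set_mult_def by blast
    have yH: "y \<in> H" using zy(2) group.lcs_subset[OF subgroup_imp_group[OF H]] by fastforce
    have zyc: "z \<in> carrier G" "y \<in> carrier G"
      using zy(1) lcs_subset yH subgroup.subset[OF H] by blast+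
    have "commutator G (s [^] m) y \<in> HH"
      using group.commutator_lcs[OF subgroup_imp_group[OF H], of "s [^] m" y n] m(2) zy(2)
        commutator_sub[OF H m(2) yH] unfolding HH_def by (simp del: lcs.simps)
    moreover have "commutator G (s [^] m) z \<in> V"
      using commutator_lcs[OF _ zy(1)] V(2) car by blast
    \<comment> \<open>[s^m, z y] is [s^m, z] times a conjugate of [s^m, y]. The first factor lies in
      the next term of the series, the second in \<open>V\<close> because \<open>V\<close> is
      normal.\<close>
    ultimately have "commutator G (s [^] m) (x [^] k) \<in> V"
      unfolding zy(3) using car zyc V(3) by (auto simp: commutator_mult_right intro!: V.inv_op_closed2)
    moreover have sx: "commutator G (s [^] i) x \<in> lcs G (Suc n)" for i :: nat
      using commutator_lcs[of "s [^] i" x n] x car by (simp del: lcs.simps)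
    have T: "commutator G (commutator G a x) b \<in> lcs G (Suc (Suc n))" if "a \<in> carrier G" "b \<in> carrier G" for a b
    proof -
      have "inv (commutator G b (commutator G a x)) \<in> lcs G (Suc (Suc n))"
        using that x commutator_lcs by (intro T.m_inv_closed) blast
      then show ?thesis using that car by (simp add: inv_commutator del: lcs.simps)
    qed
    have "lcs G (Suc (Suc n)) #> commutator G (s [^] m) (x [^] k) = lcs G (Suc (Suc n)) #> commutator G (s [^] m) x [^] k"
      using T car by (intro T.commutator_pow_right_mod) auto
    ultimately have "commutator G (s [^] m) x [^] k \<in> V"
      using T.mem_supergroup_cong[OF V(1,2), of "commutator G (s [^] m) (x [^] k)" "commutator G (s [^] m) x [^] k"] car
      by blast
    \<comment> \<open>The two exponents are pulled out one at a time: k from the right argument puts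
      [s^m, x] into \<open>W\<close>, then m from the left argument puts [s, x]^m there. A further
      root l yields the exponent m l for [s, x] itself.\<close>
    then have "commutator G (s [^] m) x \<in> W"
      using sx k(1) unfolding W_def by blast
    moreover have "lcs G (Suc (Suc n)) #> commutator G (s [^] m) x = lcs G (Suc (Suc n)) #> commutator G s x [^] m"
      using T car by (intro T.commutator_pow_left_mod) auto
    ultimately have "commutator G s x [^] m \<in> W"
      using T.mem_supergroup_cong[OF W TW, of "commutator G (s [^] m) x" "commutator G s x [^] m"] car by blast
    then obtain l :: nat where "l > 0" "(commutator G s x [^] m) [^] l \<in> V" unfolding W_def by blast
    then have "m * l > 0" "commutator G s x [^] (m * l) \<in> V"
      using m(1) car by (simp_all add: nat_pow_pow)
    moreover have "commutator G s x \<in> lcs G (Suc n)" using sx[of 1] car by simp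
    ultimately show ?thesis unfolding W_def by (intro CollectI conjI exI[of _ "m * l"])
  qed
  \<comment> \<open>The whole of \<open>lcs G n\<close> serves as generating set \<open>D\<close>,
    since every element of it is covered by the induction hypothesis.\<close>
  moreover have "lcs G n \<subseteq> generate G (lcs G n \<union> lcs G (Suc n))"
    by (auto simp del: lcs.simps intro: generate.incl)
  moreover have "W \<subseteq> lcs G (Suc n)" unfolding W_def by blast
  ultimately have "lcs G (Suc n) \<subseteq> W"
    using lcs_Suc_subset_if_generators[OF Suc.hyps S lcs_subset _ W TW] by blast
  then show ?case
    using Suc.prems unfolding W_def V_def HH_def by blast
qed

text \<open>A power of g is pushed into \<open>lcs G (Suc n) <#> H\<close> for growing n, until the
  first factor is trivial. If the power is z h, then z commutes with h modulo the next term, so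
  raising to the exponent that \<open>lcs_roots_mod_next\<close> gives for z moves the product one
  term down.\<close>

theorem nilpotent_roots_of_generators:
  assumes nilp: "lcs G (Suc c) = {\<one>}"
    and H: "subgroup H G" and S: "generate G S = carrier G" "S \<subseteq> carrier G"
    and roots: "\<And>s. s \<in> S \<Longrightarrow> \<exists>m::nat. m > 0 \<and> s [^] m \<in> H"
    and g: "g \<in> carrier G"
  shows "\<exists>m::nat. m > 0 \<and> g [^] m \<in> H"
proof -
  have "\<exists>m::nat. m > 0 \<and> g [^] m \<in> lcs G (Suc n) <#> H" for n
  proof (induction n)
    case 0
    have "g [^] (1::nat) \<in> lcs G (Suc 0) <#> H"
      using lcs_mult_subgroup(2)[OF H, of "Suc 0"] g by auto
    then show ?case by blast
  next
    case (Suc n)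
    define V where "V = lcs G (Suc (Suc n)) <#> H"
    have V: "subgroup V G" "lcs G (Suc (Suc n)) \<subseteq> V" "H \<subseteq> V"
      unfolding V_def using H by (rule lcs_mult_subgroup)+
    from Suc obtain m :: nat and z h where m: "m > 0" "z \<in> lcs G (Suc n)" "h \<in> H" "g [^] m = z \<otimes> h"
      unfolding set_mult_def by blast
    have car: "z \<in> carrier G" "h \<in> carrier G"
      using m lcs_subset subgroup.subset[OF H] by blast+
    obtain k :: nat where k: "k > 0" "z [^] k \<in> lcs G (Suc (Suc n)) <#> lcs (G\<lparr>carrier := H\<rparr>) (Suc n)"
      using lcs_roots_mod_next[OF H S roots _ m(2)] by blast
    have "lcs (G\<lparr>carrier := H\<rparr>) (Suc n) \<subseteq> H"
      using group.lcs_subset[OF subgroup_imp_group[OF H]] by fastforce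
    then have "z [^] k \<in> V"
      using k(2) mono_set_mult unfolding V_def by blast
    moreover have "h [^] k \<in> V"
      using subgroup_pow_mult(1)[OF H car(2), of 1 k] m(3) car V(3) by auto
    moreover have "commutator G z h \<in> lcs G (Suc (Suc n))"
      using commutator_lcs[OF car(2) m(2)] inv_commutator[OF car(2,1)]
        subgroup.m_inv_closed[OF lcs_subgroup, of "commutator G h z" "Suc (Suc n)"]
      by (simp del: lcs.simps)
    ultimately have "(g [^] m) [^] k \<in> V"
      unfolding m(4) using normal.pow_mult_mod[OF lcs_normal V(1,2) car] by blast
    then have "m * k > 0" "g [^] (m * k) \<in> V" using m(1) k(1) g by (simp_all add: nat_pow_pow)
    then show ?case unfolding V_def by blast
  qed
  from this[of c] show ?thesis
    using subgroup.subset[OF H] unfolding nilp by (auto simp: set_mult_def subset_iff)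
qed

lemma isolator_mono: "L \<subseteq> L' \<Longrightarrow> isolator G L \<subseteq> isolator G L'"
  by (auto simp: isolator_def)

lemma subset_isolator: "L \<subseteq> carrier G \<Longrightarrow> L \<subseteq> isolator G L"
  by (force simp: isolator_def intro: exI[of _ 1])

lemma isolator_root:
  assumes "x \<in> carrier G" "m > 0" "x [^] (m::nat) \<in> isolator G L"
  shows "x \<in> isolator G L"
proof -
  obtain k :: nat where "k > 0" "(x [^] m) [^] k \<in> L" using assms by (auto simp: isolator_def)
  then have "m * k > 0" "x [^] (m * k) \<in> L" using assms by (simp_all add: nat_pow_pow)
  then show ?thesis using assms(1) unfolding isolator_def by blast
qed

text \<open>The root theorem is applied inside the subgroup generated by the isolator: its
  generators have powers in \<open>L\<close>, hence so do all its elements, and generating has added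
  nothing.\<close>

lemma nilpotent_isolator_subgroup:
  assumes nilp: "lcs G (Suc c) = {\<one>}" and L: "subgroup L G"
  shows "subgroup (isolator G L) G"
proof -
  define K where "K = generate G (isolator G L)"
  have sub: "isolator G L \<subseteq> carrier G" by (auto simp: isolator_def)
  have K: "subgroup K G" unfolding K_def using sub by (rule generate_is_subgroup)
  have incl: "isolator G L \<subseteq> K" unfolding K_def by (auto intro: generate.incl)
  have LK: "L \<subseteq> K" using subset_isolator[OF subgroup.subset[OF L]] incl by blast
  interpret K: group "G\<lparr>carrier := K\<rparr>" using K by (rule subgroup_imp_group)
  have "lcs (G\<lparr>carrier := K\<rparr>) (Suc c) = {\<one>}"
    using lcs_subgroup_mono[OF K, of "Suc c"] subgroup.one_closed[OF K.lcs_subgroup[of "Suc c"]] nilp by auto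
  moreover have "subgroup L (G\<lparr>carrier := K\<rparr>)" using subgroup_incl[OF L K LK] .
  moreover have "generate (G\<lparr>carrier := K\<rparr>) (isolator G L) = K"
    using generate_consistent[OF incl K] by (simp add: K_def)
  ultimately have "\<exists>m::nat. m > 0 \<and> g [^] m \<in> L" if "g \<in> K" for g
    using K.nilpotent_roots_of_generators[of c L "isolator G L" g] incl that
    by (simp add: isolator_def flip: nat_pow_consistent del: lcs.simps)
  then have "K = isolator G L"
    using incl subgroup.subset[OF K] by (auto simp: isolator_def)
  then show ?thesis using K by simp
qed

text \<open>Descending induction from the trivial term. A power of x in \<open>lcs G n\<close> is z
  y with z in the next term, which is isolated over H by induction, and y in the n-th term of H; the
  isolator is a subgroup closed under roots, so it contains x.\<close>

lemma nilpotent_lcs_subset_isolator: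
  assumes nilp: "lcs G (Suc c) = {\<one>}" and H: "subgroup H G"
    and roots: "carrier G \<subseteq> isolator G H"
  shows "lcs G n \<subseteq> isolator G (lcs (G\<lparr>carrier := H\<rparr>) n)"
proof -
  have one: "\<one> \<in> isolator G (lcs (G\<lparr>carrier := H\<rparr>) k)" for k
    using nilpotent_isolator_subgroup[OF nilp lcs_sub_subgroup[OF H]] by (rule subgroup.one_closed)
  have gen: "generate G (carrier G) = carrier G"
    using generate_incl[OF order_refl] generate.incl[of _ "carrier G" G] by (intro equalityI subsetI) auto
  show ?thesis
  proof (cases "n \<le> Suc c")
    case False
    then have "lcs G n \<subseteq> {\<one>}" using lcs_antimono[of "Suc c" n] nilp by simp
    then show ?thesis using one by blast
  next
    case True
    then show ?thesis
    proof (induction n rule: inc_induct)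
      case base
      show ?case unfolding nilp using one by blast
    next
      case (step n)
      let ?I = "isolator G (lcs (G\<lparr>carrier := H\<rparr>) n)"
      show ?case
      proof (cases "n = 0")
        case True
        then show ?thesis using roots by simp
      next
        case False
        have I: "subgroup ?I G" using nilpotent_isolator_subgroup[OF nilp lcs_sub_subgroup[OF H]] .
        have sub: "lcs G (Suc n) \<subseteq> ?I"
          using step.IH isolator_mono[OF group.lcs_Suc_subset[OF subgroup_imp_group[OF H]]] by blast
        show ?thesis
        proof
          fix x assume x: "x \<in> lcs G n"
          have "\<exists>k::nat. k > 0 \<and> x [^] k \<in> lcs G (Suc n) <#> lcs (G\<lparr>carrier := H\<rparr>) n"
            using False x roots gen
            by (intro lcs_roots_mod_next[OF H, of "carrier G"]) (auto simp: isolator_def)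
          then obtain k :: nat and z y where "k > 0" "z \<in> lcs G (Suc n)" "y \<in> lcs (G\<lparr>carrier := H\<rparr>) n" "x [^] k = z \<otimes> y"
            unfolding set_mult_def by blast
          moreover have "y \<in> ?I"
            using subset_isolator[OF subgroup.subset[OF lcs_sub_subgroup[OF H]]] calculation(3) by blast
          ultimately have "x [^] k \<in> ?I" using sub subgroup.m_closed[OF I] by auto
          then show "x \<in> ?I" using isolator_root \<open>k > 0\<close> x lcs_subset by blast
        qed
      qed
    qed
  qed
qed

end

section \<open>The isolated lower central series\<close>

locale nilpotent_group = group +
  fixes c :: nat
  assumes nilp: "lcs G (Suc c) = {\<one>}"
begin

lemma iso_lcs_subgroup: "subgroup (iso_lcs G n) G"
  unfolding iso_lcs_def using nilp lcs_subgroup by (rule nilpotent_isolator_subgroup)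

lemma iso_lcs_subset: "iso_lcs G n \<subseteq> carrier G"
  by (auto simp: iso_lcs_def isolator_def)

lemma iso_lcs_normal: "iso_lcs G n \<lhd> G"
proof -
  have "a \<otimes> x \<otimes> inv a \<in> iso_lcs G n" if a: "a \<in> carrier G" and x: "x \<in> iso_lcs G n" for a x
  proof -
    obtain m :: nat where m: "m > 0" "x [^] m \<in> lcs G n" and xc: "x \<in> carrier G"
      using x unfolding iso_lcs_def isolator_def by blast
    have "(a \<otimes> x \<otimes> inv a) [^] m \<in> lcs G n"
      unfolding conj_nat_pow[OF a xc] using a m(2) by (rule normal.inv_op_closed2[OF lcs_normal])
    then show ?thesis using m(1) a xc by (auto simp: iso_lcs_def isolator_def)
  qed
  then show ?thesis using iso_lcs_subgroup by (simp add: normal_inv_iff)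
qed

lemma lcs_subset_iso_lcs: "lcs G n \<subseteq> iso_lcs G n"
  unfolding iso_lcs_def by (rule subset_isolator[OF lcs_subset])

lemma iso_lcs_Suc_subset: "iso_lcs G (Suc n) \<subseteq> iso_lcs G n"
  unfolding iso_lcs_def by (rule isolator_mono[OF lcs_Suc_subset])

lemma iso_lcs_root:
  "x \<in> carrier G \<Longrightarrow> m > 0 \<Longrightarrow> x [^] (m::nat) \<in> iso_lcs G n \<Longrightarrow> x \<in> iso_lcs G n"
  unfolding iso_lcs_def by (rule isolator_root)

lemma iso_lcs_Suc_0: "iso_lcs G (Suc 0) = carrier G"
  using lcs_subset_iso_lcs[of "Suc 0"] iso_lcs_subset[of "Suc 0"] by auto

text \<open>Descending induction on the depth of the left argument: modulo the isolator, its commutator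
  with x commutes with x, so taking powers of x amounts to taking powers of the commutator.\<close>

lemma commutator_iso_lcs:
  assumes a: "a \<in> carrier G" and x: "x \<in> iso_lcs G n"
  shows "commutator G a x \<in> iso_lcs G (Suc n)"
proof -
  interpret T: normal "iso_lcs G (Suc n)" G by (rule iso_lcs_normal)
  obtain m :: nat where m: "m > 0" "x [^] m \<in> lcs G n" and xc: "x \<in> carrier G"
    using x unfolding iso_lcs_def isolator_def by blast
  have "commutator G b x \<in> iso_lcs G (Suc n)" if "j \<le> Suc c" "b \<in> lcs G j" for j b
    using that
  proof (induction j arbitrary: b rule: inc_induct)
    case base
    then have "b = \<one>" unfolding nilp by blast
    then show ?case using xc by (simp add: commutator_def)
  next
    case (step j)
    have bc: "b \<in> carrier G" using step.prems lcs_subset by blast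
    have "commutator G b x \<in> lcs G (Suc j)"
      using subgroup.m_inv_closed[OF lcs_subgroup commutator_lcs[OF xc step.prems]]
      unfolding inv_commutator[OF xc bc] .
    then have "commutator G (commutator G b x) x \<in> iso_lcs G (Suc n)"
      by (rule step.IH)
    then have "iso_lcs G (Suc n) #> commutator G b (x [^] m) = iso_lcs G (Suc n) #> commutator G b x [^] m"
      using bc xc by (intro T.commutator_pow_right_mod)
    moreover have "commutator G b (x [^] m) \<in> iso_lcs G (Suc n)"
      using commutator_lcs[OF bc m(2)] lcs_subset_iso_lcs by blast
    ultimately have "commutator G b x [^] m \<in> iso_lcs G (Suc n)"
      using T.mem_supergroup_cong[OF iso_lcs_subgroup order_refl,
          of "commutator G b (x [^] m)" "commutator G b x [^] m"] bc xc by blast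
    then show ?case using iso_lcs_root m(1) bc xc by blast
  qed
  \<comment> \<open>\<open>lcs G 0\<close> is the whole group, so the descent ends at an arbitrary
    left argument.\<close>
  from this[of 0 a] show ?thesis using a by simp
qed

text \<open>The inclusion from right to left is the substantial one: a power of x lies in
  \<open>lcs G n\<close>, and a further power of that lies in the n-th term of
  \<open>H\<close>.\<close>

lemma iso_lcs_of_virtual_subgroup:
  assumes H: "subgroup H G" and "carrier G \<subseteq> isolator G H"
  shows "iso_lcs (G\<lparr>carrier := H\<rparr>) n = H \<inter> iso_lcs G n"
proof
  have iso: "iso_lcs (G\<lparr>carrier := H\<rparr>) n = H \<inter> isolator G (lcs (G\<lparr>carrier := H\<rparr>) n)"
    using subgroup.subset[OF H] by (auto simp: iso_lcs_def isolator_def simp flip: nat_pow_consistent)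
  then show "iso_lcs (G\<lparr>carrier := H\<rparr>) n \<subseteq> H \<inter> iso_lcs G n"
    using isolator_mono[OF lcs_subgroup_mono[OF H, of n]] unfolding iso_lcs_def by blast
  show "H \<inter> iso_lcs G n \<subseteq> iso_lcs (G\<lparr>carrier := H\<rparr>) n"
  proof
    fix x assume x: "x \<in> H \<inter> iso_lcs G n"
    then obtain m :: nat where m: "m > 0" "x [^] m \<in> lcs G n" and xc: "x \<in> carrier G"
      by (auto simp: iso_lcs_def isolator_def)
    then have "x [^] m \<in> isolator G (lcs (G\<lparr>carrier := H\<rparr>) n)"
      using nilpotent_lcs_subset_isolator[OF nilp assms] by blast
    then have "x \<in> isolator G (lcs (G\<lparr>carrier := H\<rparr>) n)"
      using isolator_root m(1) xc by blast
    then show "x \<in> iso_lcs (G\<lparr>carrier := H\<rparr>) n"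
      using x iso by blast
  qed
qed

lemma iso_lcs_trivial:
  assumes "torsion_free G"
  shows "iso_lcs G (Suc c) = {\<one>}"
proof -
  have "x = \<one>" if "x \<in> iso_lcs G (Suc c)" for x
    using assms that unfolding iso_lcs_def isolator_def nilp torsion_free_def by blast
  then show ?thesis using subgroup.one_closed[OF iso_lcs_subgroup[of "Suc c"]] by blast
qed

end

text \<open>Commutators of generators of the group with generators of one layer generate the next
  layer.\<close>

lemma (in group) lcs_layer_finitely_generated:
  assumes "finitely_generated G" "n > 0"
  shows "\<exists>D. finite D \<and> D \<subseteq> lcs G n \<and> lcs G n \<subseteq> generate G (D \<union> lcs G (Suc n))"
proof -
  obtain S where S: "finite S" "S \<subseteq> carrier G" "generate G S = carrier G"
    using assms(1) by (auto simp: finitely_generated_def)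
  show ?thesis using assms(2)
  proof (induction n rule: nat_induct_non_zero)
    case 1
    have "carrier G \<subseteq> generate G (S \<union> lcs G 2)"
      using S(3) mono_generate[of S "S \<union> lcs G 2"] by blast
    then show ?case using S by (intro exI[of _ S]) (simp add: numeral_2_eq_2)
  next
    case (Suc n)
    then obtain D where D: "finite D" "D \<subseteq> lcs G n" "lcs G n \<subseteq> generate G (D \<union> lcs G (Suc n))"
      by blast
    define E where "E = (\<lambda>(s, d). commutator G s d) ` (S \<times> D)"
    define W where "W = generate G (E \<union> lcs G (Suc (Suc n)))"
    have E: "E \<subseteq> lcs G (Suc n)"
    proof
      fix w assume "w \<in> E"
      then obtain s d where "s \<in> S" "d \<in> D" "w = commutator G s d"
        unfolding E_def by auto
      then show "w \<in> lcs G (Suc n)" using S(2) D(2) commutator_lcs[of s d n] by blast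
    qed
    have "E \<union> lcs G (Suc (Suc n)) \<subseteq> lcs G (Suc n)"
      using E lcs_Suc_subset[of "Suc n"] by blast
    then have W: "subgroup W G" "W \<subseteq> lcs G (Suc n)"
      unfolding W_def using generate_is_subgroup[OF order_trans[OF _ lcs_subset]]
        generate_subgroup_incl[OF _ lcs_subgroup] by blast+
    have "lcs G (Suc n) \<subseteq> W"
    proof (rule lcs_Suc_subset_if_generators[OF Suc.hyps S(3,2) _ D(3) W(1) _ W(2)])
      show "D \<subseteq> carrier G" using D(2) lcs_subset by blast
      show "lcs G (Suc (Suc n)) \<subseteq> W" unfolding W_def by (auto simp del: lcs.simps intro: generate.incl)
      show "commutator G s x \<in> W" if "s \<in> S" "x \<in> D" for s x
        unfolding W_def E_def using that by (intro generate.incl) auto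
    qed
    then show ?case
      using E S(1) D(1) unfolding W_def by (intro exI[of _ E]) (auto simp: E_def)
  qed
qed

section \<open>Layers of the isolated lower central series\<close>

context nilpotent_group
begin

lemma coset_hom: "group_hom G (G Mod iso_lcs G i) ((#>) (iso_lcs G i))"
  using iso_lcs_normal by (rule normal.group_hom_coset)

lemma iso_lcs_coset_eq_iff:
  assumes "a \<in> carrier G" "b \<in> carrier G"
  shows "iso_lcs G i #> a = iso_lcs G i #> b \<longleftrightarrow> a \<otimes> inv b \<in> iso_lcs G i"
  using iso_lcs_normal assms by (rule normal.coset_eq_iff)

lemma iso_lcs_coset_eq_self_iff:
  assumes "u \<in> carrier G"
  shows "iso_lcs G i #> u = iso_lcs G i \<longleftrightarrow> u \<in> iso_lcs G i"
  using normal.coset_eq_one_iff[OF iso_lcs_normal assms] by simp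

lemma coset_eq_coarser:
  assumes "a \<in> carrier G" "b \<in> carrier G" "iso_lcs G (Suc i) #> a = iso_lcs G (Suc i) #> b"
  shows "iso_lcs G i #> a = iso_lcs G i #> b"
  using assms iso_lcs_Suc_subset by (auto simp: iso_lcs_coset_eq_iff)

lemma coset_right_cancel:
  assumes "a \<in> carrier G" "b \<in> carrier G" "x \<in> carrier G"
  shows "iso_lcs G i #> (a \<otimes> x) = iso_lcs G i #> (b \<otimes> x) \<longleftrightarrow> iso_lcs G i #> a = iso_lcs G i #> b"
  using assms by (simp add: iso_lcs_coset_eq_iff group_normalize)

lemma iso_lcs_central_mod:
  assumes "u \<in> iso_lcs G i" "a \<in> carrier G"
  shows "iso_lcs G (Suc i) #> (a \<otimes> u) = iso_lcs G (Suc i) #> (u \<otimes> a)"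
proof -
  have u: "u \<in> carrier G" using assms(1) iso_lcs_subset by blast
  have "a \<otimes> u \<otimes> inv (u \<otimes> a) = commutator G a u"
    using u assms(2) by (simp add: commutator_def group_normalize)
  then show ?thesis
    using u assms commutator_iso_lcs by (subst iso_lcs_coset_eq_iff) auto
qed

lemma layer_hom:
  "group_hom (G\<lparr>carrier := iso_lcs G i\<rparr>) (layer G i) ((#>) (iso_lcs G (Suc i)))"
proof -
  have "iso_lcs G (Suc i) \<lhd> G\<lparr>carrier := iso_lcs G i\<rparr>"
    using normal_restrict_supergroup[OF iso_lcs_subgroup iso_lcs_normal iso_lcs_Suc_subset] .
  moreover have "(#>\<^bsub>G\<lparr>carrier := iso_lcs G i\<rparr>\<^esub>) = (#>)"
    by (intro ext) (simp add: r_coset_def)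
  ultimately show ?thesis
    using normal.group_hom_coset unfolding layer_def by metis
qed

lemma carrier_layer: "carrier (layer G i) = (#>) (iso_lcs G (Suc i)) ` iso_lcs G i"
  unfolding layer_def carrier_FactGroup by (auto simp: r_coset_def)

lemma one_layer: "\<one>\<^bsub>layer G i\<^esub> = iso_lcs G (Suc i)"
  by (simp add: layer_def)

lemma layer_coset_mult:
  assumes "u \<in> iso_lcs G i" "v \<in> iso_lcs G i"
  shows "(iso_lcs G (Suc i) #> u) \<otimes>\<^bsub>layer G i\<^esub> (iso_lcs G (Suc i) #> v) = iso_lcs G (Suc i) #> (u \<otimes> v)"
  using group_hom.hom_mult[OF layer_hom, of u i v] assms by simp

lemma layer_coset_inv:
  assumes "u \<in> iso_lcs G i"
  shows "inv\<^bsub>layer G i\<^esub> (iso_lcs G (Suc i) #> u) = iso_lcs G (Suc i) #> inv u"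
  using group_hom.hom_inv[OF layer_hom, of u i] assms m_inv_consistent[OF iso_lcs_subgroup] by simp

lemma layer_coset_pow:
  assumes "u \<in> iso_lcs G i"
  shows "(iso_lcs G (Suc i) #> u) [^]\<^bsub>layer G i\<^esub> (n::nat) = iso_lcs G (Suc i) #> u [^] n"
  using group_hom.hom_nat_pow[OF layer_hom, of u i n] assms by (simp flip: nat_pow_consistent)

lemma layer_comm_group: "comm_group (layer G i)"
proof -
  interpret Q: group_hom "G\<lparr>carrier := iso_lcs G i\<rparr>" "layer G i" "(#>) (iso_lcs G (Suc i))"
    by (rule layer_hom)
  show ?thesis
  proof (rule Q.H.group_comm_groupI)
    fix x y assume "x \<in> carrier (layer G i)" "y \<in> carrier (layer G i)"
    then obtain u v where uv: "u \<in> iso_lcs G i" "v \<in> iso_lcs G i"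
      "x = iso_lcs G (Suc i) #> u" "y = iso_lcs G (Suc i) #> v"
      unfolding carrier_layer by blast
    show "x \<otimes>\<^bsub>layer G i\<^esub> y = y \<otimes>\<^bsub>layer G i\<^esub> x"
      unfolding uv(3,4) layer_coset_mult[OF uv(1,2)] layer_coset_mult[OF uv(2,1)]
      using uv(1,2) iso_lcs_subset by (intro iso_lcs_central_mod) blast+
  qed
qed

lemma layer_torsion_free: "torsion_free (layer G i)"
  unfolding torsion_free_def
proof (intro ballI allI impI)
  fix x and n :: nat
  assume "x \<in> carrier (layer G i)" and n: "n > 0" "x [^]\<^bsub>layer G i\<^esub> n = \<one>\<^bsub>layer G i\<^esub>"
  then obtain u where u: "u \<in> iso_lcs G i" "x = iso_lcs G (Suc i) #> u"
    unfolding carrier_layer by blast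
  have uc: "u \<in> carrier G" using u(1) iso_lcs_subset by blast
  have "iso_lcs G (Suc i) #> u [^] n = iso_lcs G (Suc i)"
    using n(2) unfolding u(2) layer_coset_pow[OF u(1)] one_layer .
  then have "u \<in> iso_lcs G (Suc i)"
    using iso_lcs_coset_eq_self_iff uc n(1) iso_lcs_root nat_pow_closed by blast
  then show "x = \<one>\<^bsub>layer G i\<^esub>"
    unfolding u(2) one_layer using iso_lcs_coset_eq_self_iff uc by blast
qed

text \<open>Finite rank in the form needed below. An isolated layer arises from
  \<open>lcs G i\<close> by adjoining roots, so generators of \<open>lcs G i\<close> modulo
  \<open>lcs G (Suc i)\<close> reach each of its elements only up to a power. The term
  \<open>lcs G (Suc i)\<close> becomes trivial in the layer.\<close>

lemma layer_virtually_generated: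
  assumes "finitely_generated G" "i > 0"
  shows "\<exists>D. finite D \<and> D \<subseteq> carrier (layer G i) \<and>
    carrier (layer G i) \<subseteq> isolator (layer G i) (generate (layer G i) D)"
proof -
  interpret Q: group_hom "G\<lparr>carrier := iso_lcs G i\<rparr>" "layer G i" "(#>) (iso_lcs G (Suc i))"
    by (rule layer_hom)
  define \<pi> where "\<pi> = (#>) (iso_lcs G (Suc i))"
  obtain D where D: "finite D" "D \<subseteq> lcs G i" "lcs G i \<subseteq> generate G (D \<union> lcs G (Suc i))"
    using lcs_layer_finitely_generated[OF assms] by blast
  have sub: "D \<union> lcs G (Suc i) \<subseteq> iso_lcs G i"
    using D(2) lcs_Suc_subset[of i] lcs_subset_iso_lcs[of i] by blast
  have "D \<subseteq> iso_lcs G i" using sub by blast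
  then have piD: "\<pi> ` D \<subseteq> carrier (layer G i)"
    unfolding carrier_layer \<pi>_def by blast
  have gen: "generate (G\<lparr>carrier := iso_lcs G i\<rparr>) (D \<union> lcs G (Suc i)) = generate G (D \<union> lcs G (Suc i))"
    by (rule generate_consistent[OF sub iso_lcs_subgroup])
  have pi_lcs: "\<pi> u = \<one>\<^bsub>layer G i\<^esub>" if "u \<in> lcs G (Suc i)" for u
  proof -
    have "u \<in> iso_lcs G (Suc i)" using that lcs_subset_iso_lcs by blast
    then show ?thesis
      unfolding \<pi>_def one_layer using iso_lcs_coset_eq_self_iff iso_lcs_subset by blast
  qed
  have "\<pi> ` (D \<union> lcs G (Suc i)) \<subseteq> generate (layer G i) (\<pi> ` D)"
  proof
    fix q assume "q \<in> \<pi> ` (D \<union> lcs G (Suc i))"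
    then consider "q \<in> \<pi> ` D" | u where "u \<in> lcs G (Suc i)" "q = \<pi> u" by blast
    then show "q \<in> generate (layer G i) (\<pi> ` D)"
    proof cases
      case 1
      then show ?thesis by (rule generate.incl)
    next
      case 2
      then show ?thesis using pi_lcs generate.one by metis
    qed
  qed
  then have "generate (layer G i) (\<pi> ` (D \<union> lcs G (Suc i))) \<subseteq> generate (layer G i) (\<pi> ` D)"
    using Q.H.generate_subgroup_incl Q.H.generate_is_subgroup[OF piD] by blast
  moreover have "\<pi> ` generate G (D \<union> lcs G (Suc i)) = generate (layer G i) (\<pi> ` (D \<union> lcs G (Suc i)))"
    using Q.generate_img[of "D \<union> lcs G (Suc i)"] sub gen unfolding \<pi>_def by simp
  ultimately have lcs_gen: "\<pi> ` lcs G i \<subseteq> generate (layer G i) (\<pi> ` D)"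
    using D(3) by blast
  have "carrier (layer G i) \<subseteq> isolator (layer G i) (generate (layer G i) (\<pi> ` D))"
  proof
    fix q assume q: "q \<in> carrier (layer G i)"
    then obtain u where u: "u \<in> iso_lcs G i" "q = \<pi> u" unfolding carrier_layer \<pi>_def by blast
    then obtain m :: nat where m: "m > 0" "u [^] m \<in> lcs G i"
      unfolding iso_lcs_def isolator_def by blast
    have "q [^]\<^bsub>layer G i\<^esub> m = \<pi> (u [^] m)"
      unfolding u(2) \<pi>_def by (rule layer_coset_pow[OF u(1)])
    then have "q [^]\<^bsub>layer G i\<^esub> m \<in> generate (layer G i) (\<pi> ` D)"
      using m(2) lcs_gen by auto
    then show "q \<in> isolator (layer G i) (generate (layer G i) (\<pi> ` D))"
      using q m(1) unfolding isolator_def by blast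
  qed
  then show ?thesis using D(1) piD by blast
qed

end

section \<open>Virtual endomorphisms of abelian groups of finite rank\<close>

text \<open>Gaussian elimination without division: one equation and one unknown p are removed by
  cross-multiplying with the pivot.\<close>

lemma homogeneous_integer_system:
  fixes M :: "'i \<Rightarrow> 'j \<Rightarrow> int"
  assumes "finite I" "finite J" "card I < card J"
  shows "\<exists>y. (\<exists>j\<in>J. y j \<noteq> 0) \<and> (\<forall>i\<in>I. (\<Sum>j\<in>J. y j * M i j) = 0)"
  using assms
proof (induction I arbitrary: J M rule: finite_induct)
  case empty
  then have "J \<noteq> {}" by auto
  then show ?case by (intro exI[of _ "\<lambda>_. 1"]) auto
next
  case (insert i I)
  show ?case
  proof (cases "\<forall>j\<in>J. M i j = 0")
    case True
    obtain y where "\<exists>j\<in>J. y j \<noteq> 0" "\<forall>i\<in>I. (\<Sum>j\<in>J. y j * M i j) = 0"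
      using insert.IH[of J M] insert.prems insert.hyps by (metis Suc_lessD card_insert_disjoint)
    then show ?thesis using True by (intro exI[of _ y]) auto
  next
    case False
    then obtain p where p: "p \<in> J" "M i p \<noteq> 0" by blast
    define M' where "M' = (\<lambda>i' j. M i p * M i' j - M i' p * M i j)"
    have "card I < card (J - {p})"
      using insert.prems insert.hyps p(1) by simp
    then obtain y where y: "\<exists>j\<in>J - {p}. y j \<noteq> 0" "\<forall>i'\<in>I. (\<Sum>j\<in>J - {p}. y j * M' i' j) = 0"
      using insert.IH[of "J - {p}" M'] insert.prems(1) by blast
    \<comment> \<open>Back substitution scaled by the pivot: the other unknowns are multiplied by
      \<open>M i p\<close>, so that the value at p that solves equation i is an integer. As the
      pivot is non-zero, the solution stays non-trivial.\<close>
    define z where "z = (\<lambda>j. if j = p then - (\<Sum>j\<in>J - {p}. y j * M i j) else M i p * y j)"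
    have sum_z: "(\<Sum>j\<in>J. z j * M k j) = (\<Sum>j\<in>J - {p}. y j * (M i p * M k j - M k p * M i j))" for k
    proof -
      have "(\<Sum>j\<in>J. z j * M k j) = z p * M k p + (\<Sum>j\<in>J - {p}. z j * M k j)"
        using insert.prems(1) p(1) by (simp add: sum.remove)
      also have "(\<Sum>j\<in>J - {p}. z j * M k j) = (\<Sum>j\<in>J - {p}. M i p * y j * M k j)"
        by (intro sum.cong) (auto simp: z_def)
      also have "z p * M k p = (\<Sum>j\<in>J - {p}. - (y j * M i j * M k p))"
        by (simp add: z_def sum_distrib_right sum_negf)
      finally show ?thesis
        by (simp add: sum.distrib[symmetric] algebra_simps)
    qed
    have "\<exists>j\<in>J. z j \<noteq> 0" using y(1) p by (auto simp: z_def)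
    moreover have "\<forall>k\<in>insert i I. (\<Sum>j\<in>J. z j * M k j) = 0"
      using y(2) by (simp add: sum_z M'_def)
    ultimately show ?thesis by blast
  qed
qed

section \<open>Integer relations and rank in abelian groups\<close>

context comm_group
begin

lemma generate_finprod_int_pow:
  assumes "finite D" "D \<subseteq> carrier G" "x \<in> generate G D"
  shows "\<exists>e. x = finprod G (\<lambda>d. d [^] (e d :: int)) D"
  using assms(3)
proof induction
  case one
  then show ?case by (intro exI[of _ "\<lambda>_. 0"]) simp
next
  have single: "finprod G (\<lambda>d. d [^] (if d = h then k else 0 :: int)) D = h [^] k" if "h \<in> D" for h and k :: int
  proof -
    have "finprod G (\<lambda>d. d [^] (if d = h then k else 0)) D = finprod G (\<lambda>d. if h = d then d [^] k else \<one>) D"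
      using assms(2) by (intro finprod_cong') auto
    also have "\<dots> = h [^] k"
      using that assms by (intro finprod_singleton) auto
    finally show ?thesis .
  qed
  {
    case (incl h)
    then show ?case using single[of h 1] assms(2) by (metis int_pow_1 subsetD)
  next
    case (inv h)
    then show ?case using single[of h "-1"] assms(2) by (metis int_pow_1 int_pow_neg subsetD)
  }
next
  case (eng x y)
  then obtain e f where "x = finprod G (\<lambda>d. d [^] (e d :: int)) D" "y = finprod G (\<lambda>d. d [^] (f d :: int)) D"
    by blast
  then have "x \<otimes> y = finprod G (\<lambda>d. d [^] e d \<otimes> d [^] f d) D"
    using assms(2) by (subst finprod_multf) auto
  also have "\<dots> = finprod G (\<lambda>d. d [^] (e d + f d)) D"
    using assms(2) by (intro finprod_cong') (auto simp: int_pow_mult)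
  finally show ?case by (intro exI[of _ "\<lambda>d. e d + f d"])
qed

text \<open>Exponent vectors multiply like a matrix with a vector, which turns a multiplicative
  relation into a linear system.\<close>

lemma finprod_finprod_int_pow:
  assumes "finite J" "finite D" "D \<subseteq> carrier G"
  shows "finprod G (\<lambda>j. finprod G (\<lambda>d. d [^] (M d j :: int)) D [^] (y j :: int)) J
    = finprod G (\<lambda>d. d [^] (\<Sum>j\<in>J. y j * M d j)) D"
  using assms(1)
proof (induction J rule: finite_induct)
  case empty
  then show ?case by simp
next
  case (insert k J)
  have pow: "finprod G (\<lambda>d. d [^] (M d k :: int)) D [^] (y k :: int) = finprod G (\<lambda>d. d [^] (y k * M d k)) D"
    using assms(2,3)
  proof (induction D rule: finite_induct)
    case (insert d D)
    then show ?case by (simp add: int_pow_distrib Pi_def int_pow_pow subset_iff mult.commute)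
  qed simp
  have "finprod G (\<lambda>j. finprod G (\<lambda>d. d [^] (M d j :: int)) D [^] (y j :: int)) (insert k J)
    = finprod G (\<lambda>d. d [^] (y k * M d k)) D \<otimes> finprod G (\<lambda>d. d [^] (\<Sum>j\<in>J. y j * M d j)) D"
    using insert assms(3) by (simp add: pow Pi_def subset_iff)
  also have "\<dots> = finprod G (\<lambda>d. d [^] (y k * M d k) \<otimes> d [^] (\<Sum>j\<in>J. y j * M d j)) D"
    using assms(3) by (subst finprod_multf) auto
  also have "\<dots> = finprod G (\<lambda>d. d [^] (\<Sum>j\<in>insert k J. y j * M d j)) D"
    using assms(3) insert by (intro finprod_cong') (auto simp: int_pow_mult)
  finally show ?case .
qed

text \<open>Suitable powers f_j^(k_j) are words in \<open>D\<close>. There are more of them than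
  elements of \<open>D\<close>, so their exponent vectors satisfy an integer relation y, and the
  exponents k_j y_j give a relation between the f_j.\<close>

lemma dependent_if_virtually_generated:
  fixes f :: "nat \<Rightarrow> 'a"
  assumes D: "finite D" "D \<subseteq> carrier G" "card D < r"
    and f: "\<And>j. j < r \<Longrightarrow> f j \<in> isolator G (generate G D)"
  shows "\<exists>e :: nat \<Rightarrow> int. (\<exists>j<r. e j \<noteq> 0) \<and> finprod G (\<lambda>j. f j [^] e j) {..<r} = \<one>"
proof -
  have "\<exists>k::nat. \<exists>e. k > 0 \<and> f j [^] k = finprod G (\<lambda>d. d [^] (e d :: int)) D" if "j < r" for j
    using f[OF that] generate_finprod_int_pow[OF D(1,2)] unfolding isolator_def by blast
  then obtain k :: "nat \<Rightarrow> nat" and M where k: "\<And>j. j < r \<Longrightarrow> k j > 0"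
    and M: "\<And>j. j < r \<Longrightarrow> f j [^] k j = finprod G (\<lambda>d. d [^] (M j d :: int)) D"
    by metis
  obtain y where y: "\<exists>j\<in>{..<r}. y j \<noteq> 0" "\<forall>d\<in>D. (\<Sum>j<r. y j * M j d) = 0"
    using homogeneous_integer_system[of D "{..<r}" "\<lambda>d j. M j d"] D by auto
  have fc: "f j \<in> carrier G" if "j < r" for j using f[OF that] by (simp add: isolator_def)
  have "finprod G (\<lambda>j. f j [^] (int (k j) * y j)) {..<r}
    = finprod G (\<lambda>j. finprod G (\<lambda>d. d [^] (M j d :: int)) D [^] y j) {..<r}"
    using fc D(2) by (intro finprod_cong') (auto simp: M[symmetric] int_pow_int[symmetric] int_pow_pow)
  also have "\<dots> = finprod G (\<lambda>d. d [^] (\<Sum>j<r. y j * M j d)) D"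
    using finprod_finprod_int_pow[OF _ D(1,2), of "{..<r}"] by simp
  also have "\<dots> = \<one>"
    using y(2) by (intro finprod_one_eqI) auto
  finally show ?thesis
    using y(1) k by (intro exI[of _ "\<lambda>j. int (k j) * y j"]) fastforce
qed

text \<open>A substitute for rank-nullity. A longest independent family, up to powers, is lifted
  through \<psi>; a kernel element of infinite order could be added to the lifts, giving a longer
  independent family.\<close>

lemma virtually_surjective_imp_injective:
  assumes tf: "torsion_free G"
    and D: "finite D" "D \<subseteq> carrier G" "carrier G \<subseteq> isolator G (generate G D)"
    and L: "subgroup L G" and hom: "\<psi> \<in> hom (G\<lparr>carrier := L\<rparr>) G"
    and surj: "carrier G \<subseteq> isolator G (\<psi> ` L)"
    and x: "x \<in> L" "\<psi> x = \<one>"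
  shows "x = \<one>"
proof (rule ccontr)
  assume "x \<noteq> \<one>"
  interpret L: group "G\<lparr>carrier := L\<rparr>" using L by (rule subgroup_imp_group)
  interpret h: group_hom "G\<lparr>carrier := L\<rparr>" G \<psi> using hom by unfold_locales
  \<comment> \<open>Families are indexed by numbers, so a repeated entry counts as a dependence, and
    \<open>card D\<close> bounds the length.\<close>
  define indep where "indep = (\<lambda>(f :: nat \<Rightarrow> 'a) r. (\<forall>j<r. f j \<in> carrier G) \<and>
    (\<forall>e :: nat \<Rightarrow> int. finprod G (\<lambda>j. f j [^] e j) {..<r} = \<one> \<longrightarrow> (\<forall>j<r. e j = 0)))"
  have "r \<le> card D" if "indep f r" for f r
  proof (rule ccontr)
    assume "\<not> r \<le> card D"
    then show False
      using dependent_if_virtually_generated[OF D(1,2), of r f] that D(3) unfolding indep_def by force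
  qed
  moreover have "\<exists>f. indep f 0" by (simp add: indep_def)
  ultimately obtain r where "\<exists>f. indep f r" and max: "\<And>f s. indep f s \<Longrightarrow> s \<le> r"
    using Nat.ex_has_greatest_nat[of "\<lambda>r. \<exists>f. indep f r" 0 "card D"] by blast
  then obtain f where f: "indep f r" by blast
  have "\<exists>k::nat. \<exists>l. k > 0 \<and> l \<in> L \<and> f j [^] k = \<psi> l" if "j < r" for j
  proof -
    have "f j \<in> isolator G (\<psi> ` L)" using f surj that unfolding indep_def by blast
    then show ?thesis unfolding isolator_def by blast
  qed
  then obtain k :: "nat \<Rightarrow> nat" and l where k: "\<And>j. j < r \<Longrightarrow> k j > 0"
    and l: "\<And>j. j < r \<Longrightarrow> l j \<in> L" "\<And>j. j < r \<Longrightarrow> f j [^] k j = \<psi> (l j)"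
    by metis
  have LG: "L \<subseteq> carrier G" using L by (rule subgroup.subset)
  have powL: "a [^] (i::int) \<in> L" if "a \<in> L" for a i
    using subgroup_int_pow_closed[OF L that] .
  \<comment> \<open>The products are formed in \<open>G\<close> while \<psi> is multiplicative on
    \<open>L\<close> only, so membership in \<open>L\<close> and the value of \<psi> are proved
    together.\<close>
  have prodL: "finprod G (\<lambda>j. l j [^] (e j :: int)) {..<s} \<in> L \<and>
    \<psi> (finprod G (\<lambda>j. l j [^] e j) {..<s}) = finprod G (\<lambda>j. \<psi> (l j) [^] e j) {..<s}" if "s \<le> r" for e s
    using that
  proof (induction s)
    case 0
    then show ?case using subgroup.one_closed[OF L] h.hom_one by simp
  next
    case (Suc s)
    have ls: "l s \<in> L" "\<And>j. j \<le> s \<Longrightarrow> l j \<in> carrier G" "\<And>j. j \<le> s \<Longrightarrow> \<psi> (l j) \<in> carrier G"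
      using l(1) LG Suc.prems h.hom_closed by auto
    have "\<psi> (l s [^] e s) = \<psi> (l s) [^] e s"
      using h.hom_int_pow[of "l s" "e s"] ls(1) int_pow_consistent[OF L ls(1)] by simp
    moreover have "\<psi> (l s [^] e s \<otimes> finprod G (\<lambda>j. l j [^] e j) {..<s})
      = \<psi> (l s [^] e s) \<otimes> \<psi> (finprod G (\<lambda>j. l j [^] e j) {..<s})"
      using h.hom_mult[of "l s [^] e s" "finprod G (\<lambda>j. l j [^] e j) {..<s}"] Suc powL[OF ls(1)] by simp
    ultimately show ?case
      using Suc ls powL[OF ls(1)] subgroup.m_closed[OF L] by (simp add: lessThan_Suc Pi_def)
  qed
  \<comment> \<open>The kernel element takes position r. Applying \<psi> to a relation removes it
    and leaves a relation between the f_j with exponents k_j e_j, so every e_j with j < r vanishes;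
    torsion-freeness then gives e_r = 0.\<close>
  define g where "g = (\<lambda>j. if j = r then x else l j)"
  have "indep g (Suc r)"
    unfolding indep_def
  proof (intro conjI allI impI)
    show "g j \<in> carrier G" if "j < Suc r" for j
      using that x l LG by (auto simp: g_def less_Suc_eq)
    fix e :: "nat \<Rightarrow> int" and i
    assume eq: "finprod G (\<lambda>j. g j [^] e j) {..<Suc r} = \<one>" and i: "i < Suc r"
    define P where "P = finprod G (\<lambda>j. l j [^] e j) {..<r}"
    have "finprod G (\<lambda>j. g j [^] e j) {..<r} = P"
      unfolding P_def using l LG by (intro finprod_cong') (auto simp: g_def)
    then have eq': "x [^] e r \<otimes> P = \<one>"
      using eq x l LG by (simp add: lessThan_Suc Pi_def g_def subset_iff cong: if_cong)
    have P: "P \<in> L" "\<psi> P = finprod G (\<lambda>j. \<psi> (l j) [^] e j) {..<r}"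
      using prodL[of r e] by (simp_all add: P_def)
    have "\<psi> (x [^] e r) = \<one>"
      using h.hom_int_pow[of x "e r"] x int_pow_consistent[OF L x(1)] by simp
    then have "\<psi> P = \<one>"
      using h.hom_mult[of "x [^] e r" P] eq' P(1) powL[OF x(1)] h.hom_one h.hom_closed[of P] by simp
    then have "finprod G (\<lambda>j. \<psi> (l j) [^] e j) {..<r} = \<one>" using P by simp
    moreover have "finprod G (\<lambda>j. \<psi> (l j) [^] e j) {..<r} = finprod G (\<lambda>j. f j [^] (int (k j) * e j)) {..<r}"
      using f by (intro finprod_cong') (auto simp: l(2)[symmetric] indep_def int_pow_int[symmetric] int_pow_pow)
    ultimately have "finprod G (\<lambda>j. f j [^] (int (k j) * e j)) {..<r} = \<one>" by simp
    then have "\<forall>j<r. int (k j) * e j = 0"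
      using f[unfolded indep_def, THEN conjunct2, THEN spec, of "\<lambda>j. int (k j) * e j"] by blast
    then have e0: "\<forall>j<r. e j = 0" using k by fastforce
    then have "P = \<one>" unfolding P_def by (intro finprod_one_eqI) auto
    then have "x [^] e r = \<one>" using eq' x LG by auto
    have "e r = 0"
    proof (rule ccontr)
      assume "e r \<noteq> 0"
      then obtain n :: nat where n: "n > 0" "e r = int n \<or> e r = - int n"
        by (metis int_cases2 neq0_conv of_nat_0 neg_0_equal_iff_equal)
      have xc: "x \<in> carrier G" using x(1) LG by blast
      have "x [^] n = \<one>"
        using n(2)
      proof
        assume "e r = int n"
        then show ?thesis using \<open>x [^] e r = \<one>\<close> by (simp add: int_pow_int)
      next
        assume "e r = - int n"
        then have "inv (x [^] n) = \<one>" using \<open>x [^] e r = \<one>\<close> xc by (simp add: int_pow_neg_int)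
        then show ?thesis using xc by (simp add: inv_eq_1_iff)
      qed
      then show False
        using tf xc n(1) \<open>x \<noteq> \<one>\<close> unfolding torsion_free_def by blast
    qed
    then show "e i = 0" using e0 i by (auto simp: less_Suc_eq)
  qed
  then show False using max by force
qed

end

text \<open>If there are finitely many classes, every element has a power in the image of
  \<open>g \<mapsto> g \<psi>(g)\<inverse>\<close>, which is then injective because the rank is finite.\<close>

lemma (in comm_group) finite_reidemeister_imp_fixed_point_free:
  assumes tf: "torsion_free G"
    and D: "finite D" "D \<subseteq> carrier G" "carrier G \<subseteq> isolator G (generate G D)"
    and L: "subgroup L G" and hom: "\<psi> \<in> hom (G\<lparr>carrier := L\<rparr>) G"
    and fin: "finite (carrier G // reid_rel G L \<psi>)"
    and x: "x \<in> L" "\<psi> x = x"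
  shows "x = \<one>"
proof -
  interpret h: group_hom "G\<lparr>carrier := L\<rparr>" G \<psi>
    using hom subgroup_imp_group[OF L] is_group by (simp add: group_hom_def group_hom_axioms_def)
  have LG: "g \<in> carrier G" if "g \<in> L" for g using that subgroup.subset[OF L] by blast
  have psi_closed: "\<psi> g \<in> carrier G" if "g \<in> L" for g using h.hom_closed that by simp
  have psi_mult: "\<psi> (g \<otimes> k) = \<psi> g \<otimes> \<psi> k" if "g \<in> L" "k \<in> L" for g k
    using h.hom_mult[of g k] that by simp
  have psi_inv: "\<psi> (inv g) = inv (\<psi> g)" if "g \<in> L" for g
    using h.hom_inv[of g] m_inv_consistent[OF L that] that by simp
  define \<chi> where "\<chi> = (\<lambda>g. g \<otimes> inv (\<psi> g))"
  have "\<chi> \<in> hom (G\<lparr>carrier := L\<rparr>) G"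
  proof (rule homI)
    fix g k assume gk: "g \<in> carrier (G\<lparr>carrier := L\<rparr>)" "k \<in> carrier (G\<lparr>carrier := L\<rparr>)"
    then show "\<chi> g \<in> carrier G" using LG psi_closed by (simp add: \<chi>_def)
    show "\<chi> (g \<otimes>\<^bsub>G\<lparr>carrier := L\<rparr>\<^esub> k) = \<chi> g \<otimes> \<chi> k"
      using gk LG psi_closed by (simp add: \<chi>_def psi_mult inv_mult_group m_ac)
  qed
  moreover have "carrier G \<subseteq> isolator G (\<chi> ` L)"
  proof
    fix q assume q: "q \<in> carrier G"
    \<comment> \<open>By the pigeonhole principle two powers q^i and q^j share a class. In an
      abelian group their relation says that q^(j - i) is a value of \<chi>.\<close>
    have "range (\<lambda>k::nat. reid_rel G L \<psi> `` {q [^] k}) \<subseteq> carrier G // reid_rel G L \<psi>"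
      using q by (auto intro!: quotientI)
    then have "\<not> inj (\<lambda>k::nat. reid_rel G L \<psi> `` {q [^] k})"
      using fin finite_subset finite_imageD[of _ "UNIV :: nat set"] by blast
    then obtain i j :: nat where ij: "i < j" "reid_rel G L \<psi> `` {q [^] i} = reid_rel G L \<psi> `` {q [^] j}"
      unfolding inj_def by (metis linorder_neqE_nat)
    have "(q [^] i, q [^] i) \<in> reid_rel G L \<psi>"
      using q psi_inv[OF subgroup.one_closed[OF L]] h.hom_one subgroup.one_closed[OF L]
      by (auto simp: reid_rel_def intro!: bexI[of _ \<one>])
    then have "(q [^] j, q [^] i) \<in> reid_rel G L \<psi>" using ij(2) by blast
    then obtain g where g: "g \<in> L" "q [^] j = g \<otimes> q [^] i \<otimes> \<psi> (inv g)"
      by (auto simp: reid_rel_def)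
    have "q [^] (j - i) \<otimes> q [^] i = \<chi> g \<otimes> q [^] i"
      using g q ij(1) LG psi_closed by (simp add: nat_pow_mult \<chi>_def psi_inv m_ac)
    then have "q [^] (j - i) = \<chi> g"
      using g(1) q LG psi_closed by (simp add: \<chi>_def)
    then show "q \<in> isolator G (\<chi> ` L)"
      using ij(1) g(1) q by (auto simp: isolator_def intro!: exI[of _ "j - i"])
  qed
  moreover have "\<chi> x = \<one>" using x LG by (simp add: \<chi>_def)
  ultimately show ?thesis
    using virtually_surjective_imp_injective[OF tf D L _ _ x(1)] by blast
qed

section \<open>Cardinalities of quotients\<close>

definition ecard :: "'a set \<Rightarrow> enat" where
  "ecard A = (if finite A then enat (card A) else \<infinity>)"

lemma ecard_bij_betw: "bij_betw f A B \<Longrightarrow> ecard A = ecard B"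
  by (simp add: ecard_def bij_betw_finite bij_betw_same_card)

lemma ecard_eq_0_iff: "ecard A = 0 \<longleftrightarrow> A = {}"
  by (auto simp: ecard_def zero_enat_def)

lemma ecard_neq_infinity_iff: "ecard A \<noteq> \<infinity> \<longleftrightarrow> finite A"
  by (simp add: ecard_def)

lemma ecard_Times: "ecard (A \<times> B) = ecard A * ecard B"
\<comment> \<open>Empty factors are separated because 0 times \<infinity> is 0 in
  \<open>enat\<close>.\<close>
proof (cases "A = {} \<or> B = {}")
  case True
  then show ?thesis by (auto simp: ecard_def zero_enat_def)
next
  case False
  then have "ecard A \<noteq> 0" "ecard B \<noteq> 0" by (simp_all add: ecard_eq_0_iff)
  show ?thesis
  proof (cases "finite A \<and> finite B")
    case True
    then show ?thesis by (simp add: ecard_def card_cartesian_product)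
  next
    case fin: False
    then have "ecard A * ecard B = \<infinity>"
      using \<open>ecard A \<noteq> 0\<close> \<open>ecard B \<noteq> 0\<close> by (auto simp: imult_is_infinity ecard_def)
    moreover have "\<not> finite (A \<times> B)"
      using fin False by (auto simp: finite_cartesian_product_iff)
    ultimately show ?thesis by (simp add: ecard_def)
  qed
qed

lemma reidemeister_eq_ecard: "reidemeister K L \<psi> = ecard (carrier K // reid_rel K L \<psi>)"
  by (simp add: reidemeister_def ecard_def)

text \<open>Allows classes of cosets to be counted on representatives: taking images under f sends
  the class of x to the class of f x and forgets nothing, since the pulled-back relation depends on
  f x only.\<close>

lemma ecard_quotient_pullback:
  assumes surj: "f ` A = B" and s: "s \<subseteq> B \<times> B"
  shows "ecard (A // {(x, y). x \<in> A \<and> y \<in> A \<and> (f x, f y) \<in> s}) = ecard (B // s)"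
proof -
  define r where "r = {(x, y). x \<in> A \<and> y \<in> A \<and> (f x, f y) \<in> s}"
  have image: "f ` (r `` {x}) = s `` {f x}" if "x \<in> A" for x
    using that s unfolding r_def surj[symmetric] by fastforce
  have "inj_on (image f) (A // r)"
  proof (rule inj_onI)
    fix C C' assume "C \<in> A // r" "C' \<in> A // r" and eq: "f ` C = f ` C'"
    then obtain x x' where x: "x \<in> A" "C = r `` {x}" and x': "x' \<in> A" "C' = r `` {x'}"
      by (auto elim!: quotientE)
    have "s `` {f x} = s `` {f x'}" using eq image x x' by simp
    then show "C = C'" unfolding x(2) x'(2) r_def using x(1) x'(1) by auto
  qed
  moreover have "image f ` (A // r) = B // s"
  proof -
    have "image f ` (A // r) = (\<lambda>x. f ` (r `` {x})) ` A" by (auto simp: quotient_def)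
    also have "\<dots> = (\<lambda>x. s `` {f x}) ` A" using image by (intro image_cong) auto
    also have "\<dots> = B // s" unfolding surj[symmetric] by (auto simp: quotient_def)
    finally show ?thesis .
  qed
  ultimately have "bij_betw (image f) (A // r) (B // s)" by (simp add: bij_betw_def)
  then show ?thesis unfolding r_def by (rule ecard_bij_betw)
qed

lemma equiv_restrict:
  assumes "equiv A r" "B \<subseteq> A"
  shows "equiv B (r \<inter> B \<times> B)"
proof -
  have "refl_on A r" "sym r" "trans r" using assms(1) by (auto elim: equivE)
  then show ?thesis
    using assms(2) by (intro equivI refl_onI symI transI) (auto dest: refl_onD symD transD)
qed

lemma finite_quotient_coarser:
  assumes "equiv A r" "equiv A s" "r \<subseteq> s" "finite (A // r)"
  shows "finite (A // s)"
proof -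
  have "s `` (r `` {x}) = s `` {x}" if "x \<in> A" for x
  proof -
    have "x \<in> r `` {x}" using assms(1) that by (rule equiv_class_self)
    moreover have "s `` {y} = s `` {x}" if "y \<in> r `` {x}" for y
      using that assms(2,3) equiv_class_eq[of A s x y] by blast
    ultimately show ?thesis by blast
  qed
  then have "A // s \<subseteq> (\<lambda>C. s `` C) ` (A // r)"
    by (auto simp: quotient_def image_iff)
  then show ?thesis using assms(4) by (rule finite_surj[rotated])
qed

text \<open>Each s-class is swept out, up to r, by the elements m u a with u in \<open>B\<close>,
  and two parameters give the same r-class exactly when they are t-related, whatever a is. Choosing
  representatives makes the r-classes a product.\<close>

lemma ecard_quotient_fibration:
  fixes A :: "'c set" and B :: "'d set"
  assumes r: "equiv A r" and s: "equiv A s" and t: "equiv B t" and rs: "r \<subseteq> s"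
    and fib: "\<And>a u. a \<in> A \<Longrightarrow> u \<in> B \<Longrightarrow> (a, m u a) \<in> s"
    and cov: "\<And>a b. (a, b) \<in> s \<Longrightarrow> \<exists>u\<in>B. (m u a, b) \<in> r"
    and inj: "\<And>a u v. a \<in> A \<Longrightarrow> u \<in> B \<Longrightarrow> v \<in> B \<Longrightarrow> (m u a, m v a) \<in> r \<longleftrightarrow> (u, v) \<in> t"
  shows "ecard (A // r) = ecard (A // s) * ecard (B // t)"
proof -
  define rep :: "'c set \<Rightarrow> 'c" where "rep C = (SOME x. x \<in> C)" for C
  define rep' :: "'d set \<Rightarrow> 'd" where "rep' U = (SOME u. u \<in> U)" for U
  have rep: "rep C \<in> A" "s `` {rep C} = C" if "C \<in> A // s" for C
  proof -
    have "rep C \<in> C" unfolding rep_def using that s by (metis in_quotient_imp_non_empty some_in_eq)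
    then show "rep C \<in> A" "s `` {rep C} = C"
      using that s by (auto dest: in_quotient_imp_subset elim!: quotientE simp: equiv_class_eq_iff)
  qed
  have rep': "rep' U \<in> B" "t `` {rep' U} = U" if "U \<in> B // t" for U
  proof -
    have "rep' U \<in> U" unfolding rep'_def using that t by (metis in_quotient_imp_non_empty some_in_eq)
    then show "rep' U \<in> B" "t `` {rep' U} = U"
      using that t by (auto dest: in_quotient_imp_subset elim!: quotientE simp: equiv_class_eq_iff)
  qed
  define F where "F = (\<lambda>(C, U). r `` {m (rep' U) (rep C)})"
  have mA: "m u a \<in> A" if "a \<in> A" "u \<in> B" for a u
    using fib[OF that] s by (auto simp: equiv_class_eq_iff)
  have "inj_on F ((A // s) \<times> (B // t))"
  proof (rule inj_onI, clarify)
    fix C U C' U'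
    assume C: "C \<in> A // s" and C': "C' \<in> A // s" and U: "U \<in> B // t" and U': "U' \<in> B // t"
      and eq: "F (C, U) = F (C', U')"
    have rr: "(m (rep' U) (rep C), m (rep' U') (rep C')) \<in> r"
      using eq eq_equiv_class_iff[OF r mA mA] rep rep' C C' U U' unfolding F_def by simp
    have "(rep C, rep C') \<in> s"
      using rr rs fib[OF rep(1)[OF C] rep'(1)[OF U]] fib[OF rep(1)[OF C'] rep'(1)[OF U']] s
      by (meson equiv_def subsetD symD transD)
    from equiv_class_eq[OF s this] have CC: "C = C'"
      using rep(2)[OF C] rep(2)[OF C'] by simp
    then have "(rep' U, rep' U') \<in> t"
      using rr inj rep(1)[OF C'] rep'(1) U U' by simp
    from equiv_class_eq[OF t this] have "U = U'"
      using rep'(2)[OF U] rep'(2)[OF U'] by simp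
    with CC show "C = C' \<and> U = U'" by simp
  qed
  moreover have "F ` ((A // s) \<times> (B // t)) = A // r"
  proof
    show "F ` ((A // s) \<times> (B // t)) \<subseteq> A // r"
      using rep(1) rep'(1) mA unfolding F_def by (auto intro!: quotientI)
    show "A // r \<subseteq> F ` ((A // s) \<times> (B // t))"
    proof
      fix E assume "E \<in> A // r"
      then obtain b where b: "b \<in> A" "E = r `` {b}" by (rule quotientE)
      define C where "C = s `` {b}"
      have C: "C \<in> A // s" unfolding C_def using b(1) by (rule quotientI)
      then have "s `` {rep C} = s `` {b}" using rep(2) C_def by simp
      then have "(rep C, b) \<in> s" using eq_equiv_class[OF _ s b(1)] by blast
      then obtain u where u: "u \<in> B" "(m u (rep C), b) \<in> r" using cov by blast
      define U where "U = t `` {u}"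
      have U: "U \<in> B // t" unfolding U_def using u(1) by (rule quotientI)
      then have "t `` {u} = t `` {rep' U}" using rep'(2) U_def by simp
      then have "(u, rep' U) \<in> t" using eq_equiv_class[OF _ t rep'(1)[OF U]] by blast
      then have "(m u (rep C), m (rep' U) (rep C)) \<in> r"
        using inj rep(1)[OF C] u(1) rep'(1)[OF U] by blast
      from equiv_class_eq[OF r this] equiv_class_eq[OF r u(2)]
      have "r `` {m (rep' U) (rep C)} = r `` {b}" by simp
      then have "E = F (C, U)" by (simp add: F_def b(2))
      then show "E \<in> F ` ((A // s) \<times> (B // t))" using C U by blast
    qed
  qed
  ultimately have "bij_betw F ((A // s) \<times> (B // t)) (A // r)" by (simp add: bij_betw_def)
  then show ?thesis using ecard_bij_betw ecard_Times by metis
qed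

section \<open>Counting Reidemeister classes layer by layer\<close>

text \<open>Finite index enters through its consequence that every element has a power in
  \<open>H\<close>, the form that fits isolators.\<close>

locale virtual_endomorphism = nilpotent_group +
  fixes H :: "'a set" and \<phi> :: "'a \<Rightarrow> 'a"
  assumes subgroup_H: "subgroup H G" and virtual: "carrier G \<subseteq> isolator G H"
    and phi_hom: "\<phi> \<in> hom (G\<lparr>carrier := H\<rparr>) G"
    and fin_gen: "finitely_generated G"
begin

sublocale phi: group_hom "G\<lparr>carrier := H\<rparr>" G \<phi>
  using phi_hom subgroup_imp_group[OF subgroup_H] is_group by (simp add: group_hom_def group_hom_axioms_def)

lemma H_closed: "g \<in> H \<Longrightarrow> g \<in> carrier G"
  using subgroup.subset[OF subgroup_H] by blast

lemma phi_closed [simp]: "g \<in> H \<Longrightarrow> \<phi> g \<in> carrier G"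
  using phi.hom_closed by simp

lemma phi_mult: "g \<in> H \<Longrightarrow> k \<in> H \<Longrightarrow> \<phi> (g \<otimes> k) = \<phi> g \<otimes> \<phi> k"
  using phi.hom_mult by simp

lemma phi_inv: "g \<in> H \<Longrightarrow> \<phi> (inv g) = inv (\<phi> g)"
  using phi.hom_inv m_inv_consistent[OF subgroup_H] by simp

lemma phi_one: "\<phi> \<one> = \<one>"
  using phi.hom_one by simp

lemma iso_lcs_H: "iso_lcs (G\<lparr>carrier := H\<rparr>) i = H \<inter> iso_lcs G i"
  using subgroup_H virtual by (rule iso_lcs_of_virtual_subgroup)

text \<open>A power of g in \<open>lcs G i\<close> would say nothing about \<phi> g. By
  \<open>iso_lcs_H\<close> a power lies in the i-th term of the series of \<open>H\<close>, which
  \<phi> maps into \<open>lcs G i\<close>.\<close>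

lemma phi_iso_lcs:
  assumes "g \<in> H" "g \<in> iso_lcs G i"
  shows "\<phi> g \<in> iso_lcs G i"
proof -
  have "g \<in> iso_lcs (G\<lparr>carrier := H\<rparr>) i" using assms iso_lcs_H by blast
  then obtain m :: nat where m: "m > 0" "g [^] m \<in> lcs (G\<lparr>carrier := H\<rparr>) i"
    unfolding iso_lcs_def isolator_def by (auto simp flip: nat_pow_consistent)
  have "\<phi> (g [^] m) \<in> lcs G i" using phi.lcs_hom_image m(2) by blast
  moreover have "\<phi> (g [^] m) = \<phi> g [^] m"
    using phi.hom_nat_pow[of g m] assms(1) by (simp flip: nat_pow_consistent)
  ultimately show ?thesis using m(1) assms(1) by (auto simp: iso_lcs_def isolator_def)
qed

text \<open>The Reidemeister relation of the virtual endomorphism induced on the quotient by \<open>iso_lcs G i\<close>,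
  pulled back to the whole group.\<close>

definition rel_mod :: "nat \<Rightarrow> ('a \<times> 'a) set" where
  "rel_mod i = {(a, b). a \<in> carrier G \<and> b \<in> carrier G \<and>
    (\<exists>g\<in>H. iso_lcs G i #> a = iso_lcs G i #> (g \<otimes> b \<otimes> inv (\<phi> g)))}"

lemma equiv_rel_mod: "equiv (carrier G) (rel_mod i)"
proof -
  interpret q: group_hom G "G Mod iso_lcs G i" "(#>) (iso_lcs G i)" by (rule coset_hom)
  define \<pi> where "\<pi> = (#>) (iso_lcs G i)"
  have pi: "\<pi> a \<in> carrier (G Mod iso_lcs G i)" "\<pi> (inv a) = inv\<^bsub>G Mod iso_lcs G i\<^esub> \<pi> a"
    "\<pi> (a \<otimes> b) = \<pi> a \<otimes>\<^bsub>G Mod iso_lcs G i\<^esub> \<pi> b" if "a \<in> carrier G" "b \<in> carrier G" for a b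
    using that q.hom_closed q.hom_inv q.hom_mult by (simp_all add: \<pi>_def del: mult_FactGroup)
  show ?thesis
  proof (rule equivI)
    show "rel_mod i \<subseteq> carrier G \<times> carrier G" by (auto simp: rel_mod_def)
    show "refl_on (carrier G) (rel_mod i)"
      using subgroup.one_closed[OF subgroup_H] by (auto simp: refl_on_def rel_mod_def phi_one intro!: bexI[of _ \<one>])
    show "sym (rel_mod i)"
    proof (rule symI)
      fix a b assume "(a, b) \<in> rel_mod i"
      then obtain g where g: "a \<in> carrier G" "b \<in> carrier G" "g \<in> H" "\<pi> a = \<pi> (g \<otimes> b \<otimes> inv (\<phi> g))"
        by (auto simp: rel_mod_def \<pi>_def)
      have "\<pi> (inv g \<otimes> a \<otimes> inv (\<phi> (inv g))) = \<pi> (inv g) \<otimes>\<^bsub>G Mod iso_lcs G i\<^esub> \<pi> a \<otimes>\<^bsub>G Mod iso_lcs G i\<^esub> \<pi> (\<phi> g)"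
        using g H_closed pi by (simp add: phi_inv del: mult_FactGroup)
      also have "\<dots> = \<pi> (inv g \<otimes> (g \<otimes> b \<otimes> inv (\<phi> g)) \<otimes> \<phi> g)"
        using g H_closed pi by (simp del: mult_FactGroup)
      also have "inv g \<otimes> (g \<otimes> b \<otimes> inv (\<phi> g)) \<otimes> \<phi> g = b"
        using g H_closed by (simp add: group_normalize)
      finally show "(b, a) \<in> rel_mod i"
        using g subgroup.m_inv_closed[OF subgroup_H g(3)] by (auto simp: rel_mod_def \<pi>_def intro!: bexI[of _ "inv g"])
    qed
    show "trans (rel_mod i)"
    proof (rule transI)
      fix a b d assume "(a, b) \<in> rel_mod i" "(b, d) \<in> rel_mod i"
      then obtain g k where g: "a \<in> carrier G" "b \<in> carrier G" "d \<in> carrier G" "g \<in> H" "k \<in> H"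
        "\<pi> a = \<pi> (g \<otimes> b \<otimes> inv (\<phi> g))" "\<pi> b = \<pi> (k \<otimes> d \<otimes> inv (\<phi> k))"
        by (auto simp: rel_mod_def \<pi>_def)
      have "\<pi> a = \<pi> g \<otimes>\<^bsub>G Mod iso_lcs G i\<^esub> \<pi> b \<otimes>\<^bsub>G Mod iso_lcs G i\<^esub> \<pi> (inv (\<phi> g))"
        unfolding g(6) using g(1-5) H_closed pi by (simp del: mult_FactGroup)
      also have "\<dots> = \<pi> (g \<otimes> (k \<otimes> d \<otimes> inv (\<phi> k)) \<otimes> inv (\<phi> g))"
        unfolding g(7) using g(1-5) H_closed pi by (simp del: mult_FactGroup)
      also have "g \<otimes> (k \<otimes> d \<otimes> inv (\<phi> k)) \<otimes> inv (\<phi> g) = (g \<otimes> k) \<otimes> d \<otimes> inv (\<phi> (g \<otimes> k))"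
        using g(1-5) H_closed by (simp add: phi_mult group_normalize)
      finally show "(a, d) \<in> rel_mod i"
        using g subgroup.m_closed[OF subgroup_H g(4,5)] by (auto simp: rel_mod_def \<pi>_def)
    qed
  qed
qed

lemma rel_mod_Suc_subset: "rel_mod (Suc i) \<subseteq> rel_mod i"
proof -
  have "iso_lcs G i #> a = iso_lcs G i #> (g \<otimes> b \<otimes> inv (\<phi> g))"
    if "a \<in> carrier G" "b \<in> carrier G" "g \<in> H"
      "iso_lcs G (Suc i) #> a = iso_lcs G (Suc i) #> (g \<otimes> b \<otimes> inv (\<phi> g))" for a b g
  proof (rule coset_eq_coarser[OF that(1) _ that(4)])
    show "g \<otimes> b \<otimes> inv (\<phi> g) \<in> carrier G" using that(2,3) H_closed by simp
  qed
  then show ?thesis unfolding rel_mod_def by blast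
qed

section \<open>The induced endomorphisms of the layers\<close>

lemma layer_dom_eq: "layer_dom G H i = (#>) (iso_lcs G (Suc i)) ` (H \<inter> iso_lcs G i)"
  by (simp add: layer_dom_def iso_lcs_H)

lemma H_Int_iso_lcs_subgroup: "subgroup (H \<inter> iso_lcs G i) G"
  using subgroup_H iso_lcs_subgroup by (rule subgroups_Inter_pair)

lemma layer_dom_subgroup: "subgroup (layer_dom G H i) (layer G i)"
proof -
  interpret Q: group_hom "G\<lparr>carrier := iso_lcs G i\<rparr>" "layer G i" "(#>) (iso_lcs G (Suc i))"
    by (rule layer_hom)
  show ?thesis
    unfolding layer_dom_eq
    by (rule Q.subgroup_img_is_subgroup[OF subgroup_incl[OF H_Int_iso_lcs_subgroup iso_lcs_subgroup Int_lower2]])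
qed

text \<open>Independence of the chosen representative: two of them differ by an element of
  \<open>H\<close> in \<open>iso_lcs G (Suc i)\<close>, which \<phi> keeps there.\<close>

lemma induced_map_coset:
  assumes "h \<in> H" "h \<in> iso_lcs G i"
  shows "induced_map G H \<phi> i (iso_lcs G (Suc i) #> h) = iso_lcs G (Suc i) #> \<phi> h"
proof -
  define k where "k = (SOME k. k \<in> H \<inter> iso_lcs G i \<and> iso_lcs G (Suc i) #> h = iso_lcs G (Suc i) #> k)"
  have "\<exists>k. k \<in> H \<inter> iso_lcs G i \<and> iso_lcs G (Suc i) #> h = iso_lcs G (Suc i) #> k"
    using assms by blast
  from someI_ex[OF this] have "k \<in> H \<inter> iso_lcs G i \<and> iso_lcs G (Suc i) #> h = iso_lcs G (Suc i) #> k"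
    unfolding k_def .
  then have k: "k \<in> H" "iso_lcs G (Suc i) #> h = iso_lcs G (Suc i) #> k" by blast+
  then have "h \<otimes> inv k \<in> iso_lcs G (Suc i)"
    using iso_lcs_coset_eq_iff[OF H_closed H_closed, OF assms(1)] by blast
  moreover have "h \<otimes> inv k \<in> H"
    using assms(1) k(1) subgroup.m_closed[OF subgroup_H] subgroup.m_inv_closed[OF subgroup_H] by blast
  ultimately have "\<phi> (h \<otimes> inv k) \<in> iso_lcs G (Suc i)" by (intro phi_iso_lcs)
  then have "\<phi> h \<otimes> inv (\<phi> k) \<in> iso_lcs G (Suc i)"
    using assms(1) k(1) subgroup.m_inv_closed[OF subgroup_H] by (simp add: phi_mult phi_inv)
  then have "iso_lcs G (Suc i) #> \<phi> h = iso_lcs G (Suc i) #> \<phi> k"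
    using iso_lcs_coset_eq_iff assms(1) k(1) phi_closed by blast
  then show ?thesis
    by (simp add: induced_map_def iso_lcs_H k_def)
qed

lemma induced_map_hom:
  "induced_map G H \<phi> i \<in> hom ((layer G i)\<lparr>carrier := layer_dom G H i\<rparr>) (layer G i)"
proof (rule homI)
  fix x y assume "x \<in> carrier ((layer G i)\<lparr>carrier := layer_dom G H i\<rparr>)"
    "y \<in> carrier ((layer G i)\<lparr>carrier := layer_dom G H i\<rparr>)"
  then obtain g h where gh: "g \<in> H" "g \<in> iso_lcs G i" "h \<in> H" "h \<in> iso_lcs G i"
    "x = iso_lcs G (Suc i) #> g" "y = iso_lcs G (Suc i) #> h"
    by (auto simp: layer_dom_eq)
  have "\<phi> g \<in> iso_lcs G i" "\<phi> h \<in> iso_lcs G i" using gh phi_iso_lcs by blast+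
  then show "induced_map G H \<phi> i x \<in> carrier (layer G i)"
    unfolding gh(5) induced_map_coset[OF gh(1,2)] carrier_layer by blast
  have "g \<otimes> h \<in> H" "g \<otimes> h \<in> iso_lcs G i"
    using gh subgroup.m_closed[OF subgroup_H] subgroup.m_closed[OF iso_lcs_subgroup] by blast+
  then show "induced_map G H \<phi> i (x \<otimes>\<^bsub>(layer G i)\<lparr>carrier := layer_dom G H i\<rparr>\<^esub> y)
    = induced_map G H \<phi> i x \<otimes>\<^bsub>layer G i\<^esub> induced_map G H \<phi> i y"
    using gh \<open>\<phi> g \<in> iso_lcs G i\<close> \<open>\<phi> h \<in> iso_lcs G i\<close>
    by (simp add: layer_coset_mult induced_map_coset phi_mult)
qed

lemma layer_reid_rel_iff:
  assumes "u \<in> iso_lcs G i" "v \<in> iso_lcs G i"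
  shows "(iso_lcs G (Suc i) #> u, iso_lcs G (Suc i) #> v)
      \<in> reid_rel (layer G i) (layer_dom G H i) (induced_map G H \<phi> i) \<longleftrightarrow>
    (\<exists>g\<in>H \<inter> iso_lcs G i. iso_lcs G (Suc i) #> u = iso_lcs G (Suc i) #> (g \<otimes> v \<otimes> inv (\<phi> g)))"
proof -
  have "(iso_lcs G (Suc i) #> g) \<otimes>\<^bsub>layer G i\<^esub> (iso_lcs G (Suc i) #> v) \<otimes>\<^bsub>layer G i\<^esub>
      induced_map G H \<phi> i (inv\<^bsub>layer G i\<^esub> (iso_lcs G (Suc i) #> g))
      = iso_lcs G (Suc i) #> (g \<otimes> v \<otimes> inv (\<phi> g))" if "g \<in> H \<inter> iso_lcs G i" for g
  proof -
    have g: "g \<in> H" "g \<in> iso_lcs G i" "inv g \<in> H" "inv g \<in> iso_lcs G i"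
      using that subgroup.m_inv_closed[OF subgroup_H] subgroup.m_inv_closed[OF iso_lcs_subgroup] by blast+
    moreover have "inv (\<phi> g) \<in> iso_lcs G i"
      using phi_iso_lcs[OF g(3,4)] phi_inv[OF g(1)] by simp
    moreover have "g \<otimes> v \<in> iso_lcs G i"
      using g(2) assms(2) subgroup.m_closed[OF iso_lcs_subgroup] by blast
    ultimately show ?thesis
      using assms(2) by (simp add: layer_coset_inv induced_map_coset phi_inv layer_coset_mult)
  qed
  then show ?thesis
    using assms unfolding reid_rel_def layer_dom_eq carrier_layer by auto
qed

text \<open>Stated on elements instead of cosets, for direct comparison with
  \<open>rel_mod (Suc i)\<close>.\<close>

definition layer_rel :: "nat \<Rightarrow> ('a \<times> 'a) set" where
  "layer_rel i = {(u, v). u \<in> iso_lcs G i \<and> v \<in> iso_lcs G i \<and>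
    (iso_lcs G (Suc i) #> u, iso_lcs G (Suc i) #> v)
      \<in> reid_rel (layer G i) (layer_dom G H i) (induced_map G H \<phi> i)}"

lemma reidemeister_layer_eq:
  "reidemeister (layer G i) (layer_dom G H i) (induced_map G H \<phi> i) = ecard (iso_lcs G i // layer_rel i)"
  unfolding reidemeister_eq_ecard layer_rel_def
  by (rule ecard_quotient_pullback[symmetric]) (auto simp: carrier_layer reid_rel_def)

text \<open>Equivalently, \<open>H\<close> modulo \<open>H \<inter> iso_lcs G i\<close> acts freely
  by twisted conjugation on the quotient by \<open>iso_lcs G i\<close>.\<close>

definition fixed_point_free_mod :: "nat \<Rightarrow> bool" where
  "fixed_point_free_mod i \<longleftrightarrow> (\<forall>g\<in>H. \<forall>a\<in>carrier G.
    iso_lcs G i #> (g \<otimes> a \<otimes> inv (\<phi> g)) = iso_lcs G i #> a \<longrightarrow> g \<in> iso_lcs G i)"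

text \<open>\<phi> g also lies in \<open>iso_lcs G i\<close>, hence is central modulo the next term
  and passes a. So on each coset of \<open>iso_lcs G i\<close> the action of g is a translate of its
  action on the layer.\<close>

lemma twisted_conj_move:
  assumes "g \<in> H" "g \<in> iso_lcs G i" "v \<in> carrier G" "a \<in> carrier G"
  shows "iso_lcs G (Suc i) #> (g \<otimes> (v \<otimes> a) \<otimes> inv (\<phi> g)) = iso_lcs G (Suc i) #> (g \<otimes> v \<otimes> inv (\<phi> g) \<otimes> a)"
proof -
  interpret q: group_hom G "G Mod iso_lcs G (Suc i)" "(#>) (iso_lcs G (Suc i))" by (rule coset_hom)
  have phi: "inv (\<phi> g) \<in> iso_lcs G i"
    using assms(1,2) phi_iso_lcs subgroup.m_inv_closed[OF iso_lcs_subgroup] by blast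
  have car: "g \<in> carrier G" "inv (\<phi> g) \<in> carrier G" using assms(1) H_closed by auto
  have "iso_lcs G (Suc i) #> (g \<otimes> v \<otimes> (a \<otimes> inv (\<phi> g))) = iso_lcs G (Suc i) #> (g \<otimes> v \<otimes> (inv (\<phi> g) \<otimes> a))"
    using iso_lcs_central_mod[OF phi assms(4)] q.hom_mult[of "g \<otimes> v"] car assms(3,4)
    by (simp del: q.hom_mult mult_FactGroup)
  then show ?thesis using car assms(3,4) by (simp add: m_assoc)
qed

text \<open>Freeness at level i puts g into \<open>iso_lcs G i\<close>. Then a cancels by
  \<open>twisted_conj_move\<close>, and the coset of g is a fixed point of the induced map, hence
  trivial.\<close>

lemma fixed_point_free_mod_Suc:
  assumes "i > 0" "fixed_point_free_mod i" "finite (iso_lcs G i // layer_rel i)"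
  shows "fixed_point_free_mod (Suc i)"
  unfolding fixed_point_free_mod_def
proof (intro ballI impI)
  fix g a assume g: "g \<in> H" and a: "a \<in> carrier G"
    and eq: "iso_lcs G (Suc i) #> (g \<otimes> a \<otimes> inv (\<phi> g)) = iso_lcs G (Suc i) #> a"
  interpret Q: comm_group "layer G i" by (rule layer_comm_group)
  have car: "g \<in> carrier G" "\<phi> g \<in> carrier G" using g H_closed by auto
  have "iso_lcs G i #> (g \<otimes> a \<otimes> inv (\<phi> g)) = iso_lcs G i #> a"
    using car a by (intro coset_eq_coarser[OF _ a eq]) simp
  then have gi: "g \<in> iso_lcs G i"
    using assms(2) g a unfolding fixed_point_free_mod_def by blast
  have "iso_lcs G (Suc i) #> (g \<otimes> inv (\<phi> g) \<otimes> a) = iso_lcs G (Suc i) #> (\<one> \<otimes> a)"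
    using twisted_conj_move[OF g gi one_closed a] eq car a by simp
  then have "iso_lcs G (Suc i) #> (g \<otimes> inv (\<phi> g)) = iso_lcs G (Suc i) #> \<one>"
    using coset_right_cancel[of "g \<otimes> inv (\<phi> g)" \<one> a "Suc i"] car a by simp
  then have "g \<otimes> inv (\<phi> g) \<in> iso_lcs G (Suc i)"
    using car by (simp add: iso_lcs_coset_eq_iff)
  then have "iso_lcs G (Suc i) #> \<phi> g = iso_lcs G (Suc i) #> g"
    using iso_lcs_coset_eq_iff[OF car] by metis
  then have fixed: "induced_map G H \<phi> i (iso_lcs G (Suc i) #> g) = iso_lcs G (Suc i) #> g"
    using induced_map_coset[OF g gi] by simp
  obtain D where D: "finite D" "D \<subseteq> carrier (layer G i)"
    "carrier (layer G i) \<subseteq> isolator (layer G i) (generate (layer G i) D)"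
    using layer_virtually_generated[OF fin_gen assms(1)] by blast
  have "finite (carrier (layer G i) // reid_rel (layer G i) (layer_dom G H i) (induced_map G H \<phi> i))"
    using assms(3) reidemeister_layer_eq ecard_neq_infinity_iff reidemeister_eq_ecard by metis
  moreover have "iso_lcs G (Suc i) #> g \<in> layer_dom G H i"
    unfolding layer_dom_eq using g gi by blast
  ultimately have "iso_lcs G (Suc i) #> g = \<one>\<^bsub>layer G i\<^esub>"
    using Q.finite_reidemeister_imp_fixed_point_free[OF layer_torsion_free D layer_dom_subgroup induced_map_hom _ _ fixed]
    by blast
  then show "g \<in> iso_lcs G (Suc i)"
    unfolding one_layer iso_lcs_coset_eq_self_iff[OF car(1)] .
qed

text \<open>Modulo \<open>iso_lcs G i\<close> both u and v disappear, so any g relating u a to v a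
  fixes a there. Freeness forces g into \<open>iso_lcs G i\<close>, where it acts through the
  layer.\<close>

lemma rel_mod_translate_iff:
  assumes "fixed_point_free_mod i" "a \<in> carrier G" "u \<in> iso_lcs G i" "v \<in> iso_lcs G i"
  shows "(u \<otimes> a, v \<otimes> a) \<in> rel_mod (Suc i) \<longleftrightarrow> (u, v) \<in> layer_rel i"
proof -
  have car: "u \<in> carrier G" "v \<in> carrier G" using assms(3,4) iso_lcs_subset by blast+
  have move: "iso_lcs G (Suc i) #> (u \<otimes> a) = iso_lcs G (Suc i) #> (g \<otimes> (v \<otimes> a) \<otimes> inv (\<phi> g)) \<longleftrightarrow>
    iso_lcs G (Suc i) #> u = iso_lcs G (Suc i) #> (g \<otimes> v \<otimes> inv (\<phi> g))" if "g \<in> H" "g \<in> iso_lcs G i" for g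
    unfolding twisted_conj_move[OF that car(2) assms(2)]
    using car assms(2) that(1) H_closed by (intro coset_right_cancel) auto
  have "g \<in> iso_lcs G i" if g: "g \<in> H"
    and eq: "iso_lcs G (Suc i) #> (u \<otimes> a) = iso_lcs G (Suc i) #> (g \<otimes> (v \<otimes> a) \<otimes> inv (\<phi> g))" for g
  proof -
    interpret q: group_hom G "G Mod iso_lcs G i" "(#>) (iso_lcs G i)" by (rule coset_hom)
    have gc: "g \<in> carrier G" "\<phi> g \<in> carrier G" using g H_closed by auto
    have one: "iso_lcs G i #> u = \<one>\<^bsub>G Mod iso_lcs G i\<^esub>" "iso_lcs G i #> v = \<one>\<^bsub>G Mod iso_lcs G i\<^esub>"
      using assms(3,4) car normal.coset_eq_one_iff[OF iso_lcs_normal] by blast+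
    have "iso_lcs G i #> (u \<otimes> a) = iso_lcs G i #> (g \<otimes> (v \<otimes> a) \<otimes> inv (\<phi> g))"
      using car assms(2) gc by (intro coset_eq_coarser[OF _ _ eq]) auto
    moreover have "iso_lcs G i #> (u \<otimes> a) = iso_lcs G i #> a"
      using q.hom_mult[OF car(1) assms(2)] one q.H.l_one[OF q.hom_closed[OF assms(2)]] by simp
    moreover have "iso_lcs G i #> (v \<otimes> a) = iso_lcs G i #> a"
      using q.hom_mult[OF car(2) assms(2)] one q.H.l_one[OF q.hom_closed[OF assms(2)]] by simp
    moreover have "iso_lcs G i #> (g \<otimes> x \<otimes> inv (\<phi> g)) = (iso_lcs G i #> g) \<otimes>\<^bsub>G Mod iso_lcs G i\<^esub>
        (iso_lcs G i #> x) \<otimes>\<^bsub>G Mod iso_lcs G i\<^esub> (iso_lcs G i #> inv (\<phi> g))" if "x \<in> carrier G" for x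
      using that gc q.hom_mult by (simp del: mult_FactGroup q.hom_inv)
    ultimately have "iso_lcs G i #> (g \<otimes> a \<otimes> inv (\<phi> g)) = iso_lcs G i #> a"
      using car assms(2) by (metis m_closed)
    then show ?thesis using assms(1,2) g unfolding fixed_point_free_mod_def by blast
  qed
  moreover have "(u \<otimes> a, v \<otimes> a) \<in> rel_mod (Suc i) \<longleftrightarrow>
    (\<exists>g\<in>H. iso_lcs G (Suc i) #> (u \<otimes> a) = iso_lcs G (Suc i) #> (g \<otimes> (v \<otimes> a) \<otimes> inv (\<phi> g)))"
    unfolding rel_mod_def using car assms(2) by simp
  moreover have "(u, v) \<in> layer_rel i \<longleftrightarrow>
    (\<exists>g\<in>H \<inter> iso_lcs G i. iso_lcs G (Suc i) #> u = iso_lcs G (Suc i) #> (g \<otimes> v \<otimes> inv (\<phi> g)))"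
    unfolding layer_rel_def using layer_reid_rel_iff[OF assms(3,4)] assms(3,4) by simp
  ultimately show ?thesis
    using move by (meson IntI IntD1 IntD2)
qed

lemma ecard_rel_mod_Suc:
  assumes "fixed_point_free_mod i"
  shows "ecard (carrier G // rel_mod (Suc i)) = ecard (carrier G // rel_mod i) * ecard (iso_lcs G i // layer_rel i)"
proof (rule ecard_quotient_fibration[where m = "(\<otimes>)"])
  note iff = rel_mod_translate_iff[OF assms]
  have iff1: "(u, v) \<in> layer_rel i \<longleftrightarrow> (u, v) \<in> rel_mod (Suc i)" if "u \<in> iso_lcs G i" "v \<in> iso_lcs G i" for u v
    using iff[OF one_closed that] that iso_lcs_subset by (auto simp: subset_iff)
  \<comment> \<open>The case a = 1 exhibits \<open>layer_rel i\<close> as a restriction of an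
    equivalence relation.\<close>
  have "layer_rel i = rel_mod (Suc i) \<inter> iso_lcs G i \<times> iso_lcs G i"
    using iff1 by (auto simp: layer_rel_def)
  then show "equiv (iso_lcs G i) (layer_rel i)"
    using equiv_restrict[OF equiv_rel_mod iso_lcs_subset] by simp
  show "(a, u \<otimes> a) \<in> rel_mod i" if "a \<in> carrier G" "u \<in> iso_lcs G i" for a u
  proof -
    have u: "u \<in> carrier G" using that(2) iso_lcs_subset by blast
    have "iso_lcs G i #> a = iso_lcs G i #> (\<one> \<otimes> (u \<otimes> a) \<otimes> inv (\<phi> \<one>))"
      using that u subgroup.m_inv_closed[OF iso_lcs_subgroup that(2)]
      by (simp add: iso_lcs_coset_eq_iff group_normalize phi_one)
    then have "\<exists>g\<in>H. iso_lcs G i #> a = iso_lcs G i #> (g \<otimes> (u \<otimes> a) \<otimes> inv (\<phi> g))"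
      using subgroup.one_closed[OF subgroup_H] by (rule bexI)
    then show ?thesis
      using that(1) u by (simp add: rel_mod_def)
  qed
  show "\<exists>u\<in>iso_lcs G i. (u \<otimes> a, b) \<in> rel_mod (Suc i)" if "(a, b) \<in> rel_mod i" for a b
  proof -
    have "a \<in> carrier G" "b \<in> carrier G"
      and "\<exists>g\<in>H. iso_lcs G i #> a = iso_lcs G i #> (g \<otimes> b \<otimes> inv (\<phi> g))"
      using that by (simp_all add: rel_mod_def)
    then obtain g where g: "a \<in> carrier G" "b \<in> carrier G" "g \<in> H"
      "iso_lcs G i #> a = iso_lcs G i #> (g \<otimes> b \<otimes> inv (\<phi> g))"
      by (elim bexE)
    \<comment> \<open>The twisted conjugate w of b lies in the coset of a, so u = w a^(-1) is the
      required translation.\<close>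
    define w where "w = g \<otimes> b \<otimes> inv (\<phi> g)"
    have w: "w \<in> carrier G" unfolding w_def using g(1-3) H_closed by simp
    have "w \<otimes> inv a \<in> iso_lcs G i"
      using g(4)[symmetric, folded w_def] iso_lcs_coset_eq_iff[OF w g(1)] by (rule iffD1[rotated])
    moreover have "w \<otimes> inv a \<otimes> a = w" using w g(1) by (simp add: group_normalize)
    moreover have "(w, b) \<in> rel_mod (Suc i)"
      using w g(2) bexI[of "\<lambda>k. iso_lcs G (Suc i) #> w = iso_lcs G (Suc i) #> (k \<otimes> b \<otimes> inv (\<phi> k))", OF _ g(3)]
      by (simp add: rel_mod_def w_def)
    ultimately show ?thesis by (intro bexI[of _ "w \<otimes> inv a"]) simp
  qed
  show "(u \<otimes> a, v \<otimes> a) \<in> rel_mod (Suc i) \<longleftrightarrow> (u, v) \<in> layer_rel i"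
    if "a \<in> carrier G" "u \<in> iso_lcs G i" "v \<in> iso_lcs G i" for a u v
    using iff that .
qed (rule equiv_rel_mod rel_mod_Suc_subset)+

text \<open>Keeps a zero factor from annihilating \<infinity> in the product.\<close>

lemma layer_quotient_nonempty: "iso_lcs G i // layer_rel i \<noteq> {}"
  using subgroup.one_closed[OF iso_lcs_subgroup] by (auto simp: quotient_def)

text \<open>Freeness at one level gives the next count, and finiteness of that count gives the next
  freeness. Once a count is infinite, all later ones are infinite because the relations become
  finer.\<close>

lemma ecard_rel_mod_eq_prod:
  "ecard (carrier G // rel_mod (Suc n)) =
      (\<Prod>i\<in>{1..n}. reidemeister (layer G i) (layer_dom G H i) (induced_map G H \<phi> i)) \<and>
    (finite (carrier G // rel_mod (Suc n)) \<longrightarrow> fixed_point_free_mod (Suc n))"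
proof (induction n)
  case 0
  have "(a, b) \<in> rel_mod (Suc 0)" if "a \<in> carrier G" "b \<in> carrier G" for a b
  proof -
    have "iso_lcs G (Suc 0) #> a = iso_lcs G (Suc 0) #> (\<one> \<otimes> b \<otimes> inv (\<phi> \<one>))"
      using that phi_one by (subst iso_lcs_coset_eq_iff) (simp_all add: iso_lcs_Suc_0)
    then have "\<exists>g\<in>H. iso_lcs G (Suc 0) #> a = iso_lcs G (Suc 0) #> (g \<otimes> b \<otimes> inv (\<phi> g))"
      using subgroup.one_closed[OF subgroup_H] by (rule bexI)
    then show ?thesis using that by (simp add: rel_mod_def)
  qed
  then have "rel_mod (Suc 0) = carrier G \<times> carrier G" by (auto simp: rel_mod_def)
  then have "carrier G // rel_mod (Suc 0) = {carrier G}" by (auto simp: quotient_def)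
  then show ?case
    using H_closed by (simp add: ecard_def fixed_point_free_mod_def iso_lcs_Suc_0 one_enat_def)
next
  case (Suc n)
  let ?i = "Suc n"
  have prod: "(\<Prod>i\<in>{1..Suc n}. reidemeister (layer G i) (layer_dom G H i) (induced_map G H \<phi> i))
    = ecard (carrier G // rel_mod ?i) * ecard (iso_lcs G ?i // layer_rel ?i)"
    using Suc.IH by (simp add: reidemeister_layer_eq mult.commute)
  have fin: "finite (carrier G // rel_mod ?i)" if "finite (carrier G // rel_mod (Suc ?i))"
    using finite_quotient_coarser[OF equiv_rel_mod equiv_rel_mod rel_mod_Suc_subset that] .
  have nz: "ecard (iso_lcs G ?i // layer_rel ?i) \<noteq> 0"
    using layer_quotient_nonempty by (simp add: ecard_eq_0_iff)
  show ?case
  proof (cases "finite (carrier G // rel_mod ?i)")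
    case True
    then have fpf: "fixed_point_free_mod ?i" using Suc.IH by blast
    have card: "ecard (carrier G // rel_mod (Suc ?i)) = ecard (carrier G // rel_mod ?i) * ecard (iso_lcs G ?i // layer_rel ?i)"
      using fpf by (rule ecard_rel_mod_Suc)
    have "fixed_point_free_mod (Suc ?i)" if fin: "finite (carrier G // rel_mod (Suc ?i))"
    proof (rule fixed_point_free_mod_Suc[OF _ fpf])
      \<comment> \<open>A finite product whose first factor is non-zero has a finite second
        factor.\<close>
      have "carrier G // rel_mod ?i \<noteq> {}" using one_closed by (auto simp: quotient_def)
      then have "ecard (carrier G // rel_mod ?i) \<noteq> 0" by (simp add: ecard_eq_0_iff)
      moreover have "ecard (carrier G // rel_mod ?i) * ecard (iso_lcs G ?i // layer_rel ?i) \<noteq> \<infinity>"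
        using card fin ecard_neq_infinity_iff by metis
      ultimately show "finite (iso_lcs G ?i // layer_rel ?i)"
        using ecard_neq_infinity_iff imult_is_infinity by metis
    qed simp
    then show ?thesis using card prod by simp
  next
    case False
    then have "ecard (carrier G // rel_mod ?i) = \<infinity>" "ecard (carrier G // rel_mod (Suc ?i)) = \<infinity>"
      using fin ecard_neq_infinity_iff by metis+
    moreover have "\<infinity> * ecard (iso_lcs G ?i // layer_rel ?i) = \<infinity>"
      using nz imult_is_infinity by blast
    ultimately show ?thesis
      using prod fin False by auto
  qed
qed

text \<open>Torsion-freeness makes the last isolator trivial, so congruence modulo it is
  equality.\<close>

lemma reid_rel_eq_rel_mod:
  assumes "torsion_free G"
  shows "reid_rel G H \<phi> = rel_mod (Suc c)"
proof -
  have "{\<one>} #> a = {a}" if "a \<in> carrier G" for a using that by (simp add: r_coset_def)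
  then show ?thesis
    unfolding rel_mod_def reid_rel_def iso_lcs_trivial[OF assms]
    using H_closed by (auto simp: phi_inv)
qed

end

text \<open>Pigeonhole on the cosets of the powers of x.\<close>

lemma (in group) finite_index_virtual:
  assumes "finite_index H G"
  shows "carrier G \<subseteq> isolator G H"
proof
  fix x assume x: "x \<in> carrier G"
  have H: "subgroup H G" and fin: "finite (rcosets H)" using assms by (auto simp: finite_index_def)
  have "range (\<lambda>k::nat. H #> x [^] k) \<subseteq> rcosets H"
    using x subgroup.subset[OF H] by (auto intro!: rcosetsI)
  then have "\<not> inj (\<lambda>k::nat. H #> x [^] k)"
    using fin finite_subset finite_imageD[of _ "UNIV :: nat set"] by blast
  then obtain i j :: nat where ij: "i < j" "H #> x [^] i = H #> x [^] j"
    unfolding inj_def by (metis linorder_neqE_nat)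
  have "x [^] j \<in> H #> x [^] i" using ij(2) rcos_self[OF _ H] x by simp
  then obtain h where h: "h \<in> H" "x [^] j = h \<otimes> x [^] i" by (auto simp: r_coset_def)
  have "x [^] (j - i) \<otimes> x [^] i = h \<otimes> x [^] i"
    using h(2) ij(1) x by (simp add: nat_pow_mult)
  then have "x [^] (j - i) = h"
    using x h(1) subgroup.subset[OF H] by (simp add: subset_iff)
  then show "x \<in> isolator G H"
    using ij(1) h(1) x by (auto simp: isolator_def intro!: exI[of _ "j - i"])
qed

theorem mainTheorem4:
  fixes N :: "('a, 'b) monoid_scheme" and H :: "'a set" and \<phi> :: "'a \<Rightarrow> 'a" and c :: nat
  assumes "group N"
    and "finitely_generated N"
    and "torsion_free N"
    and "nilpotent_class N c"
    and "finite_index H N"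
    and "\<phi> \<in> hom (N\<lparr>carrier := H\<rparr>) N"
  shows "reidemeister N H \<phi> =
           (\<Prod>i\<in>{1..c}. reidemeister (layer N i) (layer_dom N H i) (induced_map N H \<phi> i))"
proof -
  interpret group N by fact
  have "lcs N (Suc c) = {\<one>\<^bsub>N\<^esub>}" "subgroup H N"
    using assms(4,5) unfolding nilpotent_class_def finite_index_def by blast+
  then interpret virtual_endomorphism N c H \<phi>
    using assms(2,6) finite_index_virtual[OF assms(5)]
    by (intro virtual_endomorphism.intro nilpotent_group.intro nilpotent_group_axioms.intro
        virtual_endomorphism_axioms.intro is_group)
  show ?thesis
    using ecard_rel_mod_eq_prod[of c] reid_rel_eq_rel_mod[OF assms(3)] by (simp add: reidemeister_eq_ecard)
qed

end
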